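(* Let $k\geq 2$ and let $\{\Omega_i\}_{i\geq 1}$ be a sequence of domains in $\mathbb{C}^k$, each biholomorphic to the unit ball of $\mathbb{C}^k$, such that $\Omega_i\subseteq\Omega_{i+1}$ for all $i\geq 1$. Put $\Omega=\bigcup_{i\geq 1}\Omega_i$ and assume that the Kobayashi (infinitesimal) metric of $\Omega$ vanishes identically. Then $\Omega$ has infinite Lebesgue volume, and the Bergman space \[ A^2(\Omega)=\Big\{f:\Omega\to\mathbb{C}\ \text{holomorphic}:\ \int_\Omega |f|^2\,dV<\infty\Big\} \] consists only of the zero function.
   Context: The Kobayashi metric vanishing identically means that the Kobayashi–Royden infinitesimal pseudometric of $\Omega$ is zero at every point and for every tangent vector. *)

theory Defs
  imports "HOL-Analysis.Analysis"
begin

text \<open>Points of C^k are modelled as vectors of type complex^'n with CARD('n) = k.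
  The norm on complex^'n is the Euclidean (Hermitian) norm, so ball 0 1 is the unit ball.\<close>

definition holo_fun :: "(complex^'n) set \<Rightarrow> (complex^'n \<Rightarrow> complex) \<Rightarrow> bool" where
  "holo_fun U f \<longleftrightarrow> (\<forall>z\<in>U. \<exists>L. (f has_derivative L) (at z) \<and>
       (\<forall>c v. L (c *s v) = c * L v))"

definition holo_map :: "(complex^'n) set \<Rightarrow> (complex^'n \<Rightarrow> complex^'m) \<Rightarrow> bool" where
  "holo_map U F \<longleftrightarrow> (\<forall>z\<in>U. \<exists>L. (F has_derivative L) (at z) \<and>
       (\<forall>c v. L (c *s v) = c *s L v))"

definition holo_curve :: "complex set \<Rightarrow> (complex \<Rightarrow> complex^'n) \<Rightarrow> bool" where
  "holo_curve U f \<longleftrightarrow> (\<forall>\<zeta>\<in>U. \<exists>w. (f has_derivative (\<lambda>h. h *s w)) (at \<zeta>))"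

definition domain :: "(complex^'n) set \<Rightarrow> bool" where
  "domain \<Omega> \<longleftrightarrow> open \<Omega> \<and> connected \<Omega> \<and> \<Omega> \<noteq> {}"

definition biholomorphic :: "(complex^'n) set \<Rightarrow> (complex^'n) set \<Rightarrow> bool" where
  "biholomorphic A B \<longleftrightarrow> (\<exists>F G. holo_map A F \<and> holo_map B G \<and> F ` A = B \<and> G ` B = A \<and>
       (\<forall>z\<in>A. G (F z) = z) \<and> (\<forall>w\<in>B. F (G w) = w))"

definition kobayashi_royden :: "(complex^'n) set \<Rightarrow> complex^'n \<Rightarrow> complex^'n \<Rightarrow> real" where
  "kobayashi_royden \<Omega> z v = Inf {1 / r | r. r > 0 \<and>
      (\<exists>f. holo_curve (ball 0 1) f \<and> f ` ball 0 1 \<subseteq> \<Omega> \<and> f 0 = z \<and>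
           (f has_derivative (\<lambda>h. h *s (complex_of_real r *s v))) (at 0))}"

definition bergman_space :: "(complex^'n) set \<Rightarrow> (complex^'n \<Rightarrow> complex) set" where
  "bergman_space \<Omega> = {f. holo_fun \<Omega> f \<and> set_integrable lebesgue \<Omega> (\<lambda>z. (cmod (f z))^2)}"

end

theory Submission
  imports Defs "HOL-Complex_Analysis.Complex_Analysis" "HOL-Library.Numeral_Type"
begin

text \<open>Fix z in \<Omega>. Since the Kobayashi metric vanishes at z, for every R there are holomorphic discs
  through z with derivative at least R in each coordinate direction; after shrinking, they all lie in one
  \<open>\<Omega>s i\<close>. Let F map \<open>\<Omega>s i\<close> biholomorphically onto the ball, with inverse G. By a Borel-Caratheodory
  estimate the affine discs tangent to the images of these discs, at half the radius, stay in the closed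
  ball. By convexity an affine map with linear part \<open>\<mu> F'(z)\<close>, \<open>\<mu> = R / (8 n)\<close>, maps the ball into itself
  and 0 to F z. Following it by G gives an injective holomorphic map H from the ball into \<Omega> with H 0 = z and
  \<open>H'(0) = \<mu> I\<close>. The mean value inequality for \<open>(f \<circ> H) det H'\<close> yields
  \<open>|f z|\<^sup>2 \<mu>\<^bsup>2n\<^esup> vol(ball) \<le> \<integral>|f|\<^sup>2\<close>, and R is arbitrary. For infinite volume take f = 1.\<close>

section \<open>Real determinants of complex-linear maps\<close>

text \<open>A Kobayashi disc controls one direction only and says nothing about the distortion of F.
  Convexity of the ball answers both points: tangent discs in the n coordinate directions average to
  an affine image of the whole ball, and since its linear part is a multiple of F'(z), following it
  by G cancels the derivative, so that \<open>\<mu>\<close> alone enters the estimate. The constant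
  8 n collects 1/2 for shrinking the discs into one \<open>\<Omega>s i\<close>, 1/2 for
  Borel-Caratheodory, 1/n for averaging over the directions and 1/2 for the midpoint that moves the
  result into the open ball. The factor det H' is present because |det H'|^2 is the real Jacobian of
  H: the integral of |(f o H) det H'|^2 over the ball is then the integral of |f|^2 over an
  injective image inside \<open>\<Omega>\<close>. Two facts behind this take most of the
  preparation: the real determinant of a complex-linear map has absolute value |det|^2, and det H'
  is continuous, and holomorphic on lines, although \<open>holo_map\<close> asks only for a
  complex-linear derivative at each point.\<close>

locale real_coordinates =
  fixes \<beta> :: "'m::{finite,wellorder} \<Rightarrow> 'a::euclidean_space"
  assumes bij_basis: "bij_betw \<beta> UNIV Basis"
begin

definition coords :: "'a \<Rightarrow> (real, 'm) vec" where "coords x = (\<chi> i. x \<bullet> \<beta> i)"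
definition of_coords :: "(real, 'm) vec \<Rightarrow> 'a" where "of_coords y = (\<Sum>i\<in>UNIV. y $ i *\<^sub>R \<beta> i)"
text \<open>The determinant of \<open>L\<close> as a real-linear endomorphism. Conjugation by
  \<open>coords\<close> is needed because \<open>det\<close> takes square matrices over a finite
  index type.\<close>

definition real_det :: "('a \<Rightarrow> 'a) \<Rightarrow> real" where
  "real_det L = det (matrix (coords \<circ> L \<circ> of_coords))"

lemma basis_in [simp]: "\<beta> i \<in> Basis"
  using bij_basis by (auto simp: bij_betw_def)

lemma basis_inner: "\<beta> i \<bullet> \<beta> j = (if i = j then 1 else 0)"
proof -
  have "\<beta> i = \<beta> j \<longleftrightarrow> i = j" using bij_basis by (auto simp: bij_betw_def inj_on_def)
  then show ?thesis by (simp add: inner_Basis)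
qed

lemma linear_coords: "linear coords"
  by (auto simp: coords_def linear_iff vec_eq_iff inner_add_left)

lemma linear_of_coords: "linear of_coords"
  by (auto simp: of_coords_def linear_iff algebra_simps sum.distrib scaleR_sum_right)

lemma coords_of_coords [simp]: "coords (of_coords y) = y"
  by (auto simp: coords_def of_coords_def vec_eq_iff inner_sum_left basis_inner if_distrib cong: if_cong)

lemma of_coords_coords [simp]: "of_coords (coords x) = x"
proof -
  have "of_coords (coords x) = (\<Sum>b\<in>Basis. (x \<bullet> b) *\<^sub>R b)"
    unfolding coords_def of_coords_def
    using sum.reindex_bij_betw[OF bij_basis, of "\<lambda>b. (x \<bullet> b) *\<^sub>R b"] by simp
  then show ?thesis by (simp add: euclidean_representation)
qed

lemma inner_coords: "coords x \<bullet> coords y = x \<bullet> y"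
proof -
  have "coords x \<bullet> coords y = (\<Sum>b\<in>Basis. (x \<bullet> b) * (y \<bullet> b))"
    unfolding coords_def inner_vec_def
    using sum.reindex_bij_betw[OF bij_basis, of "\<lambda>b. (x \<bullet> b) * (y \<bullet> b)"] by simp
  then show ?thesis by (simp add: euclidean_inner[of x y])
qed

lemma real_det_compose:
  assumes "linear L" "linear M"
  shows "real_det (L \<circ> M) = real_det L * real_det M"
proof -
  have "coords \<circ> (L \<circ> M) \<circ> of_coords = (coords \<circ> L \<circ> of_coords) \<circ> (coords \<circ> M \<circ> of_coords)"
    by (auto simp: fun_eq_iff)
  moreover have "linear (coords \<circ> L \<circ> of_coords)" "linear (coords \<circ> M \<circ> of_coords)"
    using assms linear_coords linear_of_coords by (auto intro!: linear_compose)
  ultimately show ?thesis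
    unfolding real_det_def by (simp add: matrix_compose det_mul)
qed

lemma real_det_id [simp]: "real_det (\<lambda>x. x) = 1"
proof -
  have "coords \<circ> (\<lambda>x. x) \<circ> of_coords = id" by (auto simp: fun_eq_iff)
  then show ?thesis unfolding real_det_def by (simp add: matrix_id_mat_1)
qed

lemma real_det_orthogonal:
  assumes "orthogonal_transformation L"
  shows "\<bar>real_det L\<bar> = 1"
proof -
  have "orthogonal_transformation (coords \<circ> L \<circ> of_coords)"
    using assms linear_coords linear_of_coords unfolding orthogonal_transformation_def
    by (auto intro!: linear_compose simp: inner_coords) (metis coords_of_coords inner_coords)
  then show ?thesis unfolding real_det_def using orthogonal_transformation_det by blast
qed

lemma real_det_diagonal:
  assumes "\<And>b. b \<in> Basis \<Longrightarrow> L b = c b *\<^sub>R b"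
  shows "real_det L = (\<Prod>b\<in>Basis. c b)"
proof -
  have of_axis: "of_coords (axis j 1) = \<beta> j" for j
    by (simp add: of_coords_def axis_def if_distrib[of "\<lambda>r. r *\<^sub>R _"] cong: if_cong)
  have "matrix (coords \<circ> L \<circ> of_coords) $ i $ j = (if i = j then c (\<beta> i) else 0)" for i j
    by (auto simp: matrix_def of_axis assms coords_def basis_inner)
  then have "real_det L = (\<Prod>i\<in>UNIV. c (\<beta> i))"
    unfolding real_det_def by (subst det_diagonal) auto
  then show ?thesis using prod.reindex_bij_betw[OF bij_basis, of c] by simp
qed

lemma real_det_singular:
  assumes "linear L" "L x = 0" "x \<noteq> 0"
  shows "real_det L = 0"
proof (rule ccontr)
  let ?L = "coords \<circ> L \<circ> of_coords"
  assume "real_det L \<noteq> 0"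
  moreover have lin: "linear ?L"
    using assms linear_coords linear_of_coords by (auto intro!: linear_compose)
  ultimately have "inj ?L" unfolding real_det_def using det_nz_iff_inj by blast
  moreover have "?L (coords x) = ?L 0"
    using assms linear_coords linear_of_coords by (simp add: linear_0)
  ultimately have "coords x = 0" by (meson injD)
  then have "of_coords (coords x) = 0" using linear_of_coords linear_0 by metis
  then show False using assms by simp
qed

end

text \<open>These are the elementary matrices of the elimination below: depending on
  \<open>c\<close> they scale a pivot, clear a column or add one row to another.\<close>

definition column_matrix :: "'n \<Rightarrow> 'a::comm_ring_1^'n \<Rightarrow> 'a^'n^'n" where
  "column_matrix k c = (\<chi> i j. if j = k then c $ i else if i = j then 1 else 0)"

lemma column_matrix_mult:
  fixes c x :: "'a::comm_ring_1^'n"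
  shows "column_matrix k c *v x = x + x $ k *s (c - axis k 1)"
proof -
  have "(column_matrix k c *v x) $ i = x $ i + x $ k * (c $ i - axis k 1 $ i)" for i
  proof -
    have "(column_matrix k c *v x) $ i = (\<Sum>j\<in>UNIV. (if j = k then c $ i * x $ k else if i = j then x $ j else 0))"
      unfolding column_matrix_def matrix_vector_mult_def by (auto intro!: sum.cong)
    also have "\<dots> = c $ i * x $ k + (\<Sum>j\<in>UNIV-{k}. (if i = j then x $ j else 0))"
      by (subst sum.remove[of _ k]) (auto intro!: sum.cong)
    finally show ?thesis by (auto simp: axis_def algebra_simps)
  qed
  then show ?thesis by (simp add: vec_eq_iff right_diff_distrib)
qed

lemma linear_complex_matrix: "linear ((*v) (A :: complex^'n^'m))"
  by (auto simp: linear_iff vec_eq_iff matrix_vector_mult_def algebra_simps sum.distrib scaleR_sum_right)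

lemma orthogonal_transformation_unimodular_coordinate:
  assumes "cmod u = 1"
  shows "orthogonal_transformation ((*v) (column_matrix k (axis k u)))"
proof -
  have "norm (column_matrix k (axis k u) *v x) = norm x" for x
    unfolding norm_vec_def
    by (rule arg_cong[of _ _ "\<lambda>f. L2_set f UNIV"])
       (auto simp: column_matrix_mult axis_def fun_eq_iff algebra_simps norm_mult assms
          simp flip: distrib_left)
  then show ?thesis
    by (simp add: orthogonal_transformation linear_complex_matrix)
qed

text \<open>The map factors as a shear \<open>S 1\<close> after the scaling \<open>D (c $ k)\<close>
  of one complex coordinate. By polar decomposition the scaling is an isometry (the phase) times a
  positive real factor, which acts on exactly two real basis vectors and so contributes its
  square.\<close>

lemma real_det_column_matrix:
  fixes \<beta> :: "'m::{finite,wellorder} \<Rightarrow> complex^'n" and c :: "complex^'n"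
  assumes "real_coordinates \<beta>" and ck: "c $ k \<noteq> 0"
  shows "\<bar>real_coordinates.real_det \<beta> ((*v) (column_matrix k c))\<bar> = (cmod (c $ k))\<^sup>2"
proof -
  interpret real_coordinates \<beta> by fact
  define w where "w = (1 / c $ k) *s c - axis k 1"
  have wk: "w $ k = 0" using ck by (simp add: w_def)
  define S where "S s = (*v) (column_matrix k (axis k 1 + s *s w))" for s
  define D where "D \<mu> = (*v) (column_matrix k (axis k \<mu>))" for \<mu> :: complex
  have lin: "linear (S s)" "linear (D \<mu>)" for s \<mu> by (simp_all add: S_def D_def linear_complex_matrix)
  have S: "S s x = x + (x $ k * s) *s w" for s x
    by (simp add: S_def column_matrix_mult)
  have D: "D \<mu> x = (\<chi> i. if i = k then \<mu> * x $ i else x $ i)" for \<mu> x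
    by (auto simp: D_def column_matrix_mult vec_eq_iff axis_def algebra_simps)
  \<comment> \<open>A shear is conjugate to its own square, so its determinant is 1.\<close>
  have "S 1 \<circ> S 1 = S 2"
    using wk by (auto simp: S fun_eq_iff vec_eq_iff algebra_simps)
  then have SS: "real_det (S 2) = real_det (S 1) * real_det (S 1)"
    using real_det_compose[OF lin(1) lin(1)] by metis
  have "D (1/2) \<circ> (S 1 \<circ> D 2) = S 2"
    using wk by (auto simp: S D fun_eq_iff vec_eq_iff algebra_simps)
  then have DSD: "real_det (S 2) = real_det (D (1/2)) * (real_det (S 1) * real_det (D 2))"
    using real_det_compose lin linear_compose by metis
  have "D (1/2) \<circ> D 2 = (\<lambda>x. x)"
    by (auto simp: D fun_eq_iff vec_eq_iff)
  then have DD: "real_det (D (1/2)) * real_det (D 2) = 1"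
    using real_det_compose[OF lin(2) lin(2)] real_det_id by metis
  have "S (-1) \<circ> S 1 = (\<lambda>x. x)"
    using wk by (auto simp: S fun_eq_iff vec_eq_iff algebra_simps)
  then have "real_det (S (-1)) * real_det (S 1) = 1"
    using real_det_compose[OF lin(1) lin(1)] real_det_id by metis
  then have "real_det (S 1) \<noteq> 0" by auto
  moreover have "real_det (S 1) * real_det (S 1) = real_det (S 1)"
    using SS DSD DD by (metis mult.commute mult.left_commute mult.right_neutral)
  ultimately have S1: "real_det (S 1) = 1" by simp
  have "S 1 \<circ> D (c $ k) = (*v) (column_matrix k c)"
    using ck by (auto simp: S D column_matrix_mult fun_eq_iff vec_eq_iff w_def axis_def field_simps)
  then have 1: "real_det ((*v) (column_matrix k c)) = real_det (D (c $ k))"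
    using real_det_compose[OF lin(1) lin(2)] S1 by (metis mult_1)
  have "D (of_real (cmod (c $ k))) \<circ> D (sgn (c $ k)) = D (c $ k)"
    using ck by (auto simp: D fun_eq_iff vec_eq_iff sgn_eq)
  then have 2: "real_det (D (c $ k)) = real_det (D (of_real (cmod (c $ k)))) * real_det (D (sgn (c $ k)))"
    using real_det_compose[OF lin(2) lin(2)] by metis
  have 3: "\<bar>real_det (D (sgn (c $ k)))\<bar> = 1"
    unfolding D_def using ck
    by (intro real_det_orthogonal orthogonal_transformation_unimodular_coordinate) (simp add: norm_sgn)
  have "real_det (D (of_real r)) = r\<^sup>2" for r
  proof -
    let ?c = "\<lambda>b :: complex^'n. if b $ k = 0 then 1 else r"
    have "real_det (D (of_real r)) = (\<Prod>b\<in>Basis. ?c b)"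
    proof (rule real_det_diagonal)
      fix b :: "complex^'n" assume "b \<in> Basis"
      then show "D (of_real r) b = ?c b *\<^sub>R b"
        by (auto simp: Basis_vec_def D vec_eq_iff axis_def scaleR_conv_of_real[where 'a=complex])
    qed
    also have "\<dots> = (\<Prod>b\<in>Basis \<inter> - {b :: complex^'n. b $ k = 0}. r)"
      by (simp add: prod.If_cases)
    also have "Basis \<inter> - {b :: complex^'n. b $ k = 0} = {axis k 1, axis k \<i>}"
      by (auto simp: Basis_vec_def Basis_complex_def axis_def)
    also have "(\<Prod>b\<in>{axis k 1, axis k \<i>}. r) = r\<^sup>2"
      by (simp add: axis_eq_axis power2_eq_square)
    finally show ?thesis .
  qed
  with 1 2 3 show ?thesis by (simp add: abs_mult)
qed

text \<open>Induction on the number of columns that are not standard basis vectors; a column is cleared by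
  multiplication with a column matrix, after a shear if its diagonal entry vanishes.\<close>
lemma real_det_complex_matrix:
  fixes \<beta> :: "'m::{finite,wellorder} \<Rightarrow> complex^'n" and A :: "complex^'n^'n"
  assumes "real_coordinates \<beta>"
  shows "\<bar>real_coordinates.real_det \<beta> ((*v) A)\<bar> = (cmod (det A))\<^sup>2"
proof -
  interpret real_coordinates \<beta> by fact
  define P where "P A \<longleftrightarrow> \<bar>real_det ((*v) A)\<bar> = (cmod (det A))\<^sup>2" for A :: "complex^'n^'n"
  have mult: "P (A ** B)" if "P A" "P B" for A B
  proof -
    have "(*v) (A ** B) = (*v) A \<circ> (*v) B" by (auto simp: matrix_vector_mul_assoc)
    then show ?thesis using that
      by (simp add: P_def real_det_compose linear_complex_matrix det_mul abs_mult norm_mult power_mult_distrib)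
  qed
  have col: "P (column_matrix k c)" if "c $ k \<noteq> 0" for k and c :: "complex^'n"
  proof -
    \<comment> \<open>This is the matrix of Cramer's rule for the identity matrix and the right-hand
      side \<open>c\<close>.\<close>
    have "(\<chi> i j. if j = k then (mat 1 *v c) $ i else (mat 1 :: complex^'n^'n) $ i $ j) = column_matrix k c"
      unfolding matrix_vector_mul_lid by (auto simp: column_matrix_def mat_def vec_eq_iff)
    then have "det (column_matrix k c) = c $ k"
      using cramer_lemma[of k "mat 1 :: complex^'n^'n" c] by simp
    then show ?thesis unfolding P_def using real_det_column_matrix[OF assms that] by simp
  qed
  have "finite S \<Longrightarrow> (\<And>j. j \<notin> S \<Longrightarrow> column j A = axis j 1) \<Longrightarrow> P A" for S :: "'n set" and A
  proof (induction S arbitrary: A rule: finite_induct)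
    case empty
    then have "A = mat 1" by (auto simp: vec_eq_iff column_def axis_def mat_def)
    moreover have "(*v) (mat 1 :: complex^'n^'n) = (\<lambda>x. x)" by (simp add: fun_eq_iff)
    ultimately show ?case by (simp add: P_def)
  next
    case (insert k S)
    have colmul: "column j (B ** C) = B *v column j C" for j and B C :: "complex^'n^'n"
      by (simp add: column_def matrix_matrix_mult_def matrix_vector_mult_def vec_eq_iff)
    have pivot: "P A" if A: "\<And>j. j \<notin> insert k S \<Longrightarrow> column j A = axis j 1" and kk: "column k A $ k \<noteq> 0" for A :: "complex^'n^'n"
    proof -
      define c where "c = column k A"
      \<comment> \<open>The \<open>k\<close>-th column of the inverse of
        \<open>column_matrix k c\<close>: its entries are 1 / \<open>c $ k\<close> at
        \<open>k\<close> and -\<open>c $ i\<close> / \<open>c $ k\<close> elsewhere.\<close>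
      define c' where "c' = axis k 1 + (1 / c $ k) *s (axis k 1 - c)"
      have ck: "c $ k \<noteq> 0" using kk by (simp add: c_def)
      have "column j (column_matrix k c' ** A) = axis j 1" if "j \<notin> S" for j
      proof (cases "j = k")
        case True
        then show ?thesis using ck
          by (simp add: colmul column_matrix_mult c'_def vec_eq_iff flip: c_def)
      next
        case False
        with that A show ?thesis
          by (simp add: colmul column_matrix_mult) (simp add: axis_def)
      qed
      then have P': "P (column_matrix k c' ** A)" by (rule insert.IH)
      have "column_matrix k c *v (column_matrix k c' *v x) = x" for x
        using ck by (auto simp: column_matrix_mult c'_def vec_eq_iff axis_def field_simps)
      then have "column_matrix k c ** (column_matrix k c' ** A) = A"
        by (simp add: matrix_eq matrix_vector_mul_assoc[symmetric])
      then show ?thesis using mult[OF col[OF ck] P'] by metis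
    qed
    show ?case
    proof (cases "column k A $ k = 0")
      case False
      with insert.prems pivot show ?thesis by blast
    next
      case kk: True
      define c where "c = column k A"
      show ?thesis
      proof (cases "\<exists>m\<in>S. c $ m \<noteq> 0")
        case True
        then obtain m where m: "m \<in> S" "c $ m \<noteq> 0" by blast
        then have mk: "m \<noteq> k" using insert.hyps by blast
        \<comment> \<open>Left multiplication by \<open>?R\<close> adds row \<open>m\<close> to row
          \<open>k\<close>, which makes the pivot nonzero. Because \<open>m\<close> lies in
          \<open>S\<close>, the columns that are already standard basis vectors have entry 0 in row
          \<open>m\<close> and stay unchanged. \<open>?R'\<close> undoes the operation.\<close>
        let ?R = "column_matrix m (axis m 1 + axis k 1 :: complex^'n)"
        let ?R' = "column_matrix m (axis m 1 - axis k 1 :: complex^'n)"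
        have "P (?R ** A)"
        proof (rule pivot)
          fix j assume "j \<notin> insert k S"
          then show "column j (?R ** A) = axis j 1"
            using m insert.prems by (auto simp: colmul column_matrix_mult) (auto simp: axis_def)
        next
          show "column k (?R ** A) $ k \<noteq> 0"
            using m kk by (simp add: colmul column_matrix_mult flip: c_def)
        qed
        moreover have "P ?R'" using mk by (intro col) (simp add: axis_def)
        moreover have "?R' ** (?R ** A) = A"
          using mk by (simp add: matrix_eq matrix_vector_mul_assoc[symmetric] column_matrix_mult)
             (simp add: axis_def)
        ultimately show ?thesis using mult by metis
      next
        case False
        \<comment> \<open>Now \<open>c\<close> is supported on indices whose columns are standard
          basis vectors, so \<open>A\<close> fixes \<open>c\<close>; it also maps
          \<open>axis k 1\<close> to \<open>c\<close>. The difference \<open>v\<close> is a nonzero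
          kernel vector, and both determinants vanish.\<close>
        define v where "v = axis k 1 - c"
        have "A *v c = (\<Sum>j\<in>UNIV. c $ j *s column j A)" by (rule matrix_mult_sum)
        also have "\<dots> = (\<Sum>j\<in>UNIV. c $ j *s axis j 1)"
          using False kk insert.prems by (intro sum.cong refl) (metis c_def insert_iff vector_smult_lzero)
        also have "\<dots> = c" by (rule basis_expansion)
        finally have "A *v c = c" .
        moreover have "A *v axis k 1 = c"
          by (simp add: c_def matrix_vector_mult_def column_def axis_def vec_eq_iff if_distrib cong: if_cong)
        ultimately have Av: "A *v v = 0"
          by (simp add: v_def matrix_vector_mult_diff_distrib)
        have "v $ k = 1" using kk by (simp add: v_def flip: c_def)
        then have v0: "v \<noteq> 0" by auto
        have "det A = 0"
        proof (rule ccontr)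
          assume "det A \<noteq> 0"
          then obtain B where "B ** A = mat 1"
            using invertible_det_nz[of A] by (auto simp: invertible_def)
          then have "B *v (A *v v) = v" by (simp add: matrix_vector_mul_assoc)
          with Av v0 show False by simp
        qed
        moreover have "real_det ((*v) A) = 0"
          using real_det_singular[OF linear_complex_matrix Av v0] .
        ultimately show ?thesis by (simp add: P_def)
      qed
    qed
  qed
  from this[of UNIV A] show ?thesis by (simp add: P_def)
qed

section \<open>Change of variables\<close>

context real_coordinates begin

section \<open>Invariance of Lebesgue measure and integrals under real coordinates\<close>

lemma coords_image_eq_vimage: "coords ` S = of_coords -` S"
proof
  show "of_coords -` S \<subseteq> coords ` S"
  proof
    fix y assume "y \<in> of_coords -` S"
    then have "coords (of_coords y) \<in> coords ` S" by blast
    then show "y \<in> coords ` S" by simp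
  qed
qed auto

lemma coords_measurable [measurable]: "coords \<in> borel_measurable borel"
  by (intro borel_measurable_continuous_onI linear_continuous_on linear_conv_bounded_linear[THEN iffD1] linear_coords)

lemma of_coords_measurable [measurable]: "of_coords \<in> borel_measurable borel"
  by (intro borel_measurable_continuous_onI linear_continuous_on linear_conv_bounded_linear[THEN iffD1] linear_of_coords)

text \<open>The two bases correspond bijectively, so the preimage of a box is a box with the same
  side lengths, and boxes determine Lebesgue measure.\<close>

lemma distr_lborel_coords: "distr lborel borel coords = lborel"
proof (rule lborel_eqI[symmetric])
  fix l u :: "(real, 'm) vec"
  assume lu: "\<And>b. b \<in> Basis \<Longrightarrow> l \<bullet> b \<le> u \<bullet> b"
  have of_coords_inner: "of_coords y \<bullet> \<beta> i = y $ i" for y i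
    using coords_of_coords[of y] by (simp add: coords_def vec_eq_iff)
  have all: "(\<forall>b\<in>Basis. Q b) \<longleftrightarrow> (\<forall>i. Q (\<beta> i))" for Q
    using bij_betw_imp_surj_on[OF bij_basis] by (metis rangeE rangeI)
  have "coords -` box l u = box (of_coords l) (of_coords u)"
    by (auto simp: mem_box_cart mem_box all of_coords_inner) (auto simp: coords_def)
  moreover have "\<forall>b\<in>Basis. of_coords l \<bullet> b \<le> of_coords u \<bullet> b"
    unfolding all of_coords_inner using lu[of "axis _ 1"] by (simp add: cart_eq_inner_axis)
  moreover have "(\<Prod>b\<in>Basis. (of_coords u - of_coords l) \<bullet> b) = (\<Prod>b\<in>Basis. (u - l) \<bullet> b)"
  proof -
    have "(\<Prod>b\<in>Basis. (of_coords u - of_coords l) \<bullet> b) = (\<Prod>i\<in>UNIV. (of_coords u - of_coords l) \<bullet> \<beta> i)"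
      using prod.reindex_bij_betw[OF bij_basis, of "\<lambda>b. (of_coords u - of_coords l) \<bullet> b"] by simp
    also have "\<dots> = (\<Prod>i\<in>UNIV. (u - l) $ i)"
      by (simp add: inner_diff_left of_coords_inner)
    also have "\<dots> = (\<Prod>b\<in>Basis. (u - l) \<bullet> b)"
      by (simp add: Basis_vec_def UNION_singleton_eq_range prod.reindex inj_on_def axis_eq_axis inner_axis)
    finally show ?thesis .
  qed
  ultimately show "emeasure (distr lborel borel coords) (box l u) = ennreal (\<Prod>b\<in>Basis. (u - l) \<bullet> b)"
    by (simp add: emeasure_distr emeasure_lborel_box)
qed simp

text \<open>Measurability between the completed measures also requires preimages of null sets to be
  null; this comes from the Borel-level identity \<open>distr_lborel_coords\<close>.\<close>

lemma distr_lebesgue_coords: "distr lebesgue lebesgue coords = lebesgue"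
  and coords_lebesgue_measurable: "coords \<in> lebesgue \<rightarrow>\<^sub>M lebesgue"
proof -
  have eq: "distr lebesgue lborel coords = lborel"
    using distr_lborel_coords by (simp add: distr_completion cong: distr_cong)
  show "coords \<in> lebesgue \<rightarrow>\<^sub>M lebesgue"
    by (simp add: completion.measurable_completion2 eq measurable_completion)
  show "distr lebesgue lebesgue coords = lebesgue"
    using completion.completion_distr_eq[of coords lborel lborel]
    by (simp add: eq measurable_completion)
qed

lemma of_coords_lebesgue_measurable: "of_coords \<in> lebesgue \<rightarrow>\<^sub>M lebesgue"
proof -
  have "distr lebesgue lborel of_coords = distr (distr lborel borel coords) borel of_coords"
    by (simp add: distr_completion distr_lborel_coords cong: distr_cong)
  also have "\<dots> = lborel"
    by (subst distr_distr) (auto simp: o_def distr_id2)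
  finally have "distr lebesgue lborel of_coords = lborel" .
  then show ?thesis
    by (simp add: completion.measurable_completion2 measurable_completion)
qed

lemma integrable_coords_iff:
  fixes f :: "'a \<Rightarrow> real"
  shows "integrable lebesgue (\<lambda>y. f (of_coords y)) \<longleftrightarrow> integrable lebesgue f"
proof -
  have "f \<in> borel_measurable lebesgue \<longleftrightarrow> (\<lambda>y. f (of_coords y)) \<in> borel_measurable lebesgue"
  proof
    show "(\<lambda>y. f (of_coords y)) \<in> borel_measurable lebesgue" if "f \<in> borel_measurable lebesgue"
      by (rule measurable_compose[OF of_coords_lebesgue_measurable that])
    show "f \<in> borel_measurable lebesgue" if "(\<lambda>y. f (of_coords y)) \<in> borel_measurable lebesgue"
      using measurable_compose[OF coords_lebesgue_measurable that] by simp
  qed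
  moreover have "integrable lebesgue (\<lambda>y. f (of_coords y)) \<longleftrightarrow> integrable lebesgue f"
    if "(\<lambda>y. f (of_coords y)) \<in> borel_measurable lebesgue"
    using integrable_distr_eq[OF coords_lebesgue_measurable that] by (simp add: distr_lebesgue_coords)
  ultimately show ?thesis
    using borel_measurable_integrable[of lebesgue f] borel_measurable_integrable[of lebesgue "\<lambda>y. f (of_coords y)"]
    by blast
qed

lemma integral_coords:
  fixes f :: "'a \<Rightarrow> real"
  assumes "integrable lebesgue f"
  shows "(\<integral>y. f (of_coords y) \<partial>lebesgue) = (\<integral>x. f x \<partial>lebesgue)"
proof -
  have "(\<lambda>y. f (of_coords y)) \<in> borel_measurable lebesgue"
    using assms integrable_coords_iff borel_measurable_integrable by blast
  then show ?thesis
    using integral_distr[OF coords_lebesgue_measurable, of "\<lambda>y. f (of_coords y)"]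
    by (simp add: distr_lebesgue_coords)
qed

lemma set_integrable_coords_iff:
  fixes f :: "'a \<Rightarrow> real"
  shows "set_integrable lebesgue (coords ` S) (\<lambda>y. f (of_coords y)) \<longleftrightarrow> set_integrable lebesgue S f"
proof -
  have "indicat_real (coords ` S) y = indicat_real S (of_coords y)" for y
    by (simp add: indicator_def coords_image_eq_vimage)
  then show ?thesis unfolding set_integrable_def
    using integrable_coords_iff[of "\<lambda>x. indicat_real S x *\<^sub>R f x"] by simp
qed

lemma set_integral_coords:
  fixes f :: "'a \<Rightarrow> real"
  assumes "set_integrable lebesgue S f"
  shows "(LINT y:coords ` S|lebesgue. f (of_coords y)) = (LINT x:S|lebesgue. f x)"
proof -
  have "indicat_real (coords ` S) y = indicat_real S (of_coords y)" for y
    by (simp add: indicator_def coords_image_eq_vimage)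
  then show ?thesis using assms unfolding set_integrable_def set_lebesgue_integral_def
    using integral_coords[of "\<lambda>x. indicat_real S x *\<^sub>R f x"] by simp
qed

lemma set_integral_change_of_variables:
  fixes f :: "'a \<Rightarrow> real"
  assumes S: "S \<in> sets lebesgue"
    and der: "\<And>x. x \<in> S \<Longrightarrow> (H has_derivative H' x) (at x within S)"
    and inj: "inj_on H S"
    and f: "set_integrable lebesgue (H ` S) f"
  shows "set_integrable lebesgue S (\<lambda>x. \<bar>real_det (H' x)\<bar> * f (H x))" (is ?integrable)
    and "(LINT x:S|lebesgue. \<bar>real_det (H' x)\<bar> * f (H x)) = (LINT x:H ` S|lebesgue. f x)" (is ?integral)
proof -
  define T where "T = coords ` S"
  define g where "g = coords \<circ> H \<circ> of_coords"
  define g' where "g' y = coords \<circ> H' (of_coords y) \<circ> of_coords" for y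
  \<comment> \<open>\<open>has_absolute_integral_change_of_variables\<close> treats integrands with
    values in a Cartesian space, so the scalar integrand is wrapped as a vector of length 1.\<close>
  define F :: "(real, 'm) vec \<Rightarrow> real^1" where "F y = vec (f (of_coords y))" for y
  have T: "T \<in> sets lebesgue"
    unfolding T_def coords_image_eq_vimage
    using measurable_sets[OF of_coords_lebesgue_measurable S] by simp
  have gT: "g ` T = coords ` (H ` S)" by (auto simp: g_def T_def image_iff)
  have dg: "(g has_derivative g' y) (at y within T)" if y: "y \<in> T" for y
  proof -
    have "of_coords ` T = S" by (auto simp: T_def image_iff)
    then have "(H has_derivative H' (of_coords y)) (at (of_coords y) within of_coords ` T)"
      using der y by blast
    moreover have "(of_coords has_derivative of_coords) (at y within T)"
      using linear_of_coords by (simp add: linear_imp_has_derivative)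
    moreover have "(coords has_derivative coords) (at (H (of_coords y)) within H ` of_coords ` T)"
      using linear_coords by (simp add: linear_imp_has_derivative)
    ultimately show ?thesis unfolding g_def g'_def o_assoc[symmetric]
      using diff_chain_within[OF \<open>(of_coords has_derivative of_coords) (at y within T)\<close>
          diff_chain_within[of H "H' (of_coords y)" "of_coords y" "of_coords ` T" coords coords]]
      by (simp add: o_def)
  qed
  have "inj_on g T"
  proof (rule inj_onI)
    fix y y' assume *: "y \<in> T" "y' \<in> T" "g y = g y'"
    then have "of_coords (g y) = of_coords (g y')" by simp
    then have "H (of_coords y) = H (of_coords y')" by (simp add: g_def)
    then have "of_coords y = of_coords y'" using * inj by (auto simp: T_def dest: inj_onD)
    then have "coords (of_coords y) = coords (of_coords y')" by simp
    then show "y = y'" by simp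
  qed
  have cv: "(\<lambda>y. \<bar>det (matrix (g' y))\<bar> *\<^sub>R F (g y)) absolutely_integrable_on T \<and>
      integral T (\<lambda>y. \<bar>det (matrix (g' y))\<bar> *\<^sub>R F (g y)) = integral (g ` T) F"
    if "F absolutely_integrable_on (g ` T)"
    using has_absolute_integral_change_of_variables[OF T dg \<open>inj_on g T\<close>, of F "integral (g ` T) F"] that
    by blast
  let ?h = "\<lambda>x. \<bar>real_det (H' x)\<bar> * f (H x)"
  have F1: "F y $ 1 = f (of_coords y)" for y by (simp add: F_def)
  have h1: "\<bar>det (matrix (g' y))\<bar> * f (of_coords (g y)) = ?h (of_coords y)" for y
    by (simp add: g_def g'_def real_det_def)
  have fc: "set_integrable lebesgue (g ` T) (\<lambda>y. f (of_coords y))"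
    unfolding gT set_integrable_coords_iff by (rule f)
  then have "F absolutely_integrable_on (g ` T)"
    unfolding absolutely_integrable_on_1_iff F1 .
  note cv = cv[OF this, unfolded absolutely_integrable_on_1_iff integral_on_1_eq vector_scaleR_component F1
      real_scaleR_def h1]
  have hc: "set_integrable lebesgue T (\<lambda>y. ?h (of_coords y))"
    using cv by (rule conjunct1)
  then show ?integrable unfolding T_def by (rule iffD1[OF set_integrable_coords_iff[of S ?h]])
  have "(LINT x:S|lebesgue. ?h x) = integral T (\<lambda>y. ?h (of_coords y))"
    using set_integral_coords[OF \<open>?integrable\<close>] set_lebesgue_integral_eq_integral(2)[OF hc]
    by (simp add: T_def)
  also have "\<dots> = integral (g ` T) (\<lambda>y. f (of_coords y))"
    using cv by (simp add: vec_eq_iff)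
  also have "\<dots> = (LINT x:H ` S|lebesgue. f x)"
    using set_integral_coords[OF f] set_lebesgue_integral_eq_integral(2)[OF fc]
    by (simp add: gT)
  finally show ?integral .
qed

end

text \<open>The weight is the real Jacobian rewritten by \<open>real_det_complex_matrix\<close>. In
  this form it combines with the squared modulus of a holomorphic function into the squared modulus
  of a single holomorphic function.\<close>

lemma set_integral_holomorphic_change_of_variables:
  fixes f :: "complex^'n \<Rightarrow> real" and J :: "complex^'n \<Rightarrow> complex^'n^'n"
  assumes S: "S \<in> sets lebesgue"
    and der: "\<And>x. x \<in> S \<Longrightarrow> (H has_derivative (*v) (J x)) (at x within S)"
    and inj: "inj_on H S"
    and f: "set_integrable lebesgue (H ` S) f"
  shows "set_integrable lebesgue S (\<lambda>x. (cmod (det (J x)))\<^sup>2 * f (H x))"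
    and "(LINT x:S|lebesgue. (cmod (det (J x)))\<^sup>2 * f (H x)) = (LINT x:H ` S|lebesgue. f x)"
proof -
  \<comment> \<open>The index type must be a wellorder, as the library's change of variables theorem requires one.\<close>
  have "CARD('n bit0) = card (Basis :: (complex^'n) set)"
    by simp
  then obtain \<beta> :: "'n bit0 \<Rightarrow> complex^'n" where "bij_betw \<beta> UNIV Basis"
    using finite_same_card_bij[of "UNIV :: 'n bit0 set" "Basis :: (complex^'n) set"] by auto
  then interpret real_coordinates \<beta> by unfold_locales
  show "set_integrable lebesgue S (\<lambda>x. (cmod (det (J x)))\<^sup>2 * f (H x))"
    "(LINT x:S|lebesgue. (cmod (det (J x)))\<^sup>2 * f (H x)) = (LINT x:H ` S|lebesgue. f x)"
    using set_integral_change_of_variables[OF S der inj f]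
    by (simp_all add: real_det_complex_matrix[OF real_coordinates_axioms])
qed

section \<open>Mean values and derivatives of holomorphic functions\<close>

lemma norm_vector_smult: "norm (c *s x) = cmod c * norm x" for x :: "complex^'n"
  by (simp add: norm_vec_def L2_set_def norm_mult power_mult_distrib flip: sum_distrib_left)
    (simp add: real_sqrt_mult)

text \<open>Cauchy's integral formula at the centre: on the unit circle u = \<open>cis t\<close> one
  has du / u = i dt.\<close>

lemma holomorphic_circle_mean:
  assumes "continuous_on (cball 0 1) h" "h holomorphic_on ball 0 1"
  shows "((\<lambda>t. h (cis t)) has_integral 2 * of_real pi * h 0) {0..2 * pi}"
proof -
  have "((\<lambda>u. h u / u) has_contour_integral (2 * of_real pi * \<i> * h 0)) (circlepath 0 1)"
    using Cauchy_integral_circlepath[OF assms, of 0] by simp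
  then have "((\<lambda>t. h (cis t) * \<i>) has_integral 2 * of_real pi * \<i> * h 0) {0..2 * pi}"
    unfolding circlepath_def
    by (subst (asm) has_contour_integral_part_circlepath_iff) (simp_all add: mult.assoc)
  from has_integral_mult_left[OF this, of "-\<i>"] show ?thesis
    by (simp add: algebra_simps)
qed

text \<open>The square of \<open>h\<close> is again holomorphic, so its mean value formula and the
  triangle inequality for integrals suffice. The nonnegative integral is used in view of the later
  exchange of integrations.\<close>

lemma holomorphic_square_circle_mean:
  assumes "continuous_on (cball 0 1) h" "h holomorphic_on ball 0 1"
  shows "ennreal (2 * pi * (cmod (h 0))\<^sup>2)
    \<le> (\<integral>\<^sup>+t. indicator {0..2 * pi} t * ennreal ((cmod (h (cis t)))\<^sup>2) \<partial>lborel)"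
proof -
  have cont: "continuous_on {0..2 * pi} (\<lambda>t. h (cis t))"
    by (rule continuous_on_compose2[OF assms(1)]) (auto intro!: continuous_intros)
  have int: "(\<lambda>t. (cmod (h (cis t)))\<^sup>2) integrable_on {0..2 * pi}"
    by (intro integrable_continuous_real continuous_intros cont)
  have h2: "((\<lambda>t. (h (cis t))\<^sup>2) has_integral 2 * of_real pi * (h 0)\<^sup>2) {0..2 * pi}"
    by (rule holomorphic_circle_mean[of "\<lambda>z. (h z)\<^sup>2"])
      (rule continuous_on_power[OF assms(1)], rule holomorphic_on_power[OF assms(2)])
  have "norm (integral {0..2 * pi} (\<lambda>t. (h (cis t))\<^sup>2)) \<le> integral {0..2 * pi} (\<lambda>t. (cmod (h (cis t)))\<^sup>2)"
    using h2 int by (intro Henstock_Kurzweil_Integration.integral_norm_bound_integral) (auto simp: norm_power integrable_on_def)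
  then have "2 * pi * (cmod (h 0))\<^sup>2 \<le> integral {0..2 * pi} (\<lambda>t. (cmod (h (cis t)))\<^sup>2)"
    using h2 by (simp add: integral_unique norm_mult norm_power)
  moreover have "(\<integral>\<^sup>+t. indicator {0..2 * pi} t * ennreal ((cmod (h (cis t)))\<^sup>2) \<partial>lborel)
      = ennreal (integral {0..2 * pi} (\<lambda>t. (cmod (h (cis t)))\<^sup>2))"
    using nn_integral_has_integral_lebesgue[OF _ integrable_integral[OF int]]
    by (simp add: nn_integral_completion ennreal_mult' ennreal_indicator)
  ultimately show ?thesis by (simp add: ennreal_leI)
qed

text \<open>Taylor's formula of order 1 with the second derivative bounded by Cauchy's inequality on
  circles of radius \<open>\<rho> / 4\<close>, which stay in the disc when centred in the half disc.
  The rate depends on \<open>p\<close> only through the bound \<open>M\<close>, and this gives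
  uniformity in the base point later.\<close>

lemma holomorphic_difference_quotient_bound:
  assumes "p holomorphic_on ball 0 \<rho>" "0 < \<rho>" and M: "\<And>w. w \<in> ball 0 \<rho> \<Longrightarrow> cmod (p w) \<le> M"
    and s: "cmod s \<le> \<rho> / 2" "s \<noteq> 0"
  shows "cmod ((p s - p 0) / s - deriv p 0) \<le> 2 * M / (\<rho> / 4)\<^sup>2 * cmod s"
proof -
  let ?f = "\<lambda>i. (deriv ^^ i) p"
  have sub: "cball x (\<rho> / 4) \<subseteq> ball 0 \<rho>" if "x \<in> cball 0 (\<rho> / 2)" for x :: complex
  proof
    fix y assume "y \<in> cball x (\<rho> / 4)"
    then have "norm y \<le> norm x + \<rho> / 4" using norm_triangle_ineq2[of y x] by (simp add: dist_norm norm_minus_commute)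
    then show "y \<in> ball 0 \<rho>" using that \<open>0 < \<rho>\<close> by simp
  qed
  have "cmod (?f 0 s - (\<Sum>i\<le>1. ?f i 0 * (s - 0) ^ i / fact i))
      \<le> (2 * M / (\<rho> / 4)\<^sup>2) * cmod (s - 0) ^ Suc 1 / fact 1"
  proof (rule complex_Taylor[of "cball 0 (\<rho> / 2)"])
    fix i x assume "x \<in> cball (0::complex) (\<rho> / 2)"
    then have "x \<in> ball 0 \<rho>" using \<open>0 < \<rho>\<close> by simp
    then show "(?f i has_field_derivative ?f (Suc i) x) (at x within cball 0 (\<rho> / 2))"
      using has_field_derivative_higher_deriv[OF assms(1)] has_field_derivative_at_within by blast
  next
    fix x assume x: "x \<in> cball (0::complex) (\<rho> / 2)"
    have hol: "p holomorphic_on cball x (\<rho> / 4)"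
      using assms(1) sub[OF x] holomorphic_on_subset by blast
    have "cmod (?f 2 x) \<le> fact 2 * M / (\<rho> / 4) ^ 2"
    proof (rule Cauchy_inequality)
      show "p holomorphic_on ball x (\<rho> / 4)" using hol ball_subset_cball holomorphic_on_subset by blast
      show "continuous_on (cball x (\<rho> / 4)) p" using hol holomorphic_on_imp_continuous_on by blast
      show "cmod (p y) \<le> M" if "cmod (x - y) = \<rho> / 4" for y
        using that sub[OF x] by (intro M) (auto simp: dist_norm subset_iff)
    qed (use \<open>0 < \<rho>\<close> in simp)
    then show "cmod (?f (Suc 1) x) \<le> 2 * M / (\<rho> / 4)\<^sup>2" by (simp add: numeral_2_eq_2)
  qed (use s \<open>0 < \<rho>\<close> in auto)
  then have "cmod (p s - (p 0 + deriv p 0 * s)) \<le> (2 * M / (\<rho> / 4)\<^sup>2 * cmod s) * cmod s"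
    by (simp add: power2_eq_square)
  moreover have "(p s - p 0) / s - deriv p 0 = (p s - (p 0 + deriv p 0 * s)) / s"
    using s by (simp add: field_simps)
  ultimately show ?thesis using s by (simp add: norm_divide pos_divide_le_eq del: divide_le_eq)
qed

section \<open>Regularity of directional derivatives\<close>

lemma continuous_on_vector_smult:
  fixes g :: "'b::topological_space \<Rightarrow> complex^'n"
  shows "continuous_on S f \<Longrightarrow> continuous_on S g \<Longrightarrow> continuous_on S (\<lambda>p. f p *s g p)"
  unfolding vector_scalar_mult_def by (intro continuous_intros)

lemma bounded_linear_vector_smult: "bounded_linear (\<lambda>c. c *s v)" for v :: "complex^'n"
  by (simp add: linear_conv_bounded_linear[symmetric] linear_iff vec_eq_iff algebra_simps)

lemma has_derivative_complex_line:
  fixes b :: "complex^'n"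
  shows "((\<lambda>t. a + t *s b) has_derivative (\<lambda>h. h *s b)) (at t within S)"
  by (auto intro!: derivative_eq_intros bounded_linear_imp_has_derivative bounded_linear_vector_smult)

lemma holo_fun_line_has_field_derivative:
  fixes g :: "complex^'n \<Rightarrow> complex"
  assumes "(g has_derivative L) (at (a + t *s b))" "\<And>c v. L (c *s v) = c * L v"
  shows "((\<lambda>t. g (a + t *s b)) has_field_derivative L b) (at t)"
proof -
  have "(g \<circ> (\<lambda>t. a + t *s b) has_derivative L \<circ> (\<lambda>h. h *s b)) (at t)"
    by (rule diff_chain_at[OF has_derivative_complex_line assms(1)])
  moreover have "L \<circ> (\<lambda>h. h *s b) = (*) (L b)" by (simp add: fun_eq_iff assms(2) mult.commute)
  ultimately show ?thesis by (simp add: has_field_derivative_def o_def)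
qed

lemma holo_fun_holomorphic_on_line:
  assumes "holo_fun U g"
  shows "(\<lambda>t. g (a + t *s b)) holomorphic_on {t. a + t *s b \<in> U}"
  unfolding holomorphic_on_def
proof
  fix t assume "t \<in> {t. a + t *s b \<in> U}"
  then obtain L where "(g has_derivative L) (at (a + t *s b))" "\<And>c v. L (c *s v) = c * L v"
    using assms unfolding holo_fun_def by blast
  then show "(\<lambda>t. g (a + t *s b)) field_differentiable at t within {t. a + t *s b \<in> U}"
    using holo_fun_line_has_field_derivative[of g L a t b]
    by (meson field_differentiable_at_within field_differentiable_def)
qed

lemma holo_fun_continuous_on: "holo_fun U g \<Longrightarrow> continuous_on U g"
  unfolding holo_fun_def
  by (meson continuous_at_imp_continuous_on has_derivative_continuous)

text \<open>Defined through the one-variable \<open>deriv\<close>, so that no derivative map has to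
  be chosen at each point and the Jacobian entries become explicit functions of the base
  point.\<close>

definition directional_derivative :: "(complex^'n \<Rightarrow> complex) \<Rightarrow> complex^'n \<Rightarrow> complex^'n \<Rightarrow> complex" where
  "directional_derivative g v w = deriv (\<lambda>s. g (w + s *s v)) 0"

lemma directional_derivative_eq:
  assumes "(g has_derivative L) (at z)" "\<And>c v. L (c *s v) = c * L v"
  shows "directional_derivative g v z = L v"
  unfolding directional_derivative_def
  using holo_fun_line_has_field_derivative[of g L z 0 v] assms by (auto intro: DERIV_imp_deriv)

text \<open>Differentiability in \<open>holo_fun\<close> is pointwise, so regularity of the
  derivative has to be earned. Locally uniform convergence of the quotients transfers to the limit
  both continuity and, by Weierstrass' theorem, holomorphy along lines.\<close>

lemma uniform_limit_difference_quotients: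
  fixes g :: "complex^'n \<Rightarrow> complex"
  assumes "open U" "holo_fun U g" "z \<in> U"
  obtains r s where "0 < r" "cball z r \<subseteq> U"
    "\<And>n w. w \<in> cball z r \<Longrightarrow> w + s n *s v \<in> U"
    "\<And>n. s n \<noteq> (0::complex)"
    "uniform_limit (cball z r) (\<lambda>n w. (g (w + s n *s v) - g w) / s n) (directional_derivative g v) sequentially"
proof -
  obtain r' where r': "0 < r'" "cball z r' \<subseteq> U"
    using assms open_contains_cball by blast
  define r where "r = r' / 2"
  have r: "0 < r" "cball z (2 * r) \<subseteq> U" using r' by (simp_all add: r_def)
  have "compact (g ` cball z (2 * r))"
    using holo_fun_continuous_on[OF assms(2)] r continuous_on_subset compact_continuous_image compact_cball by blast
  then obtain M where M: "\<And>w. w \<in> cball z (2 * r) \<Longrightarrow> cmod (g w) \<le> M"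
    using compact_imp_bounded bounded_iff by (metis imageI)
  \<comment> \<open>A step of length at most \<open>\<rho>\<close> along \<open>v\<close> moves a
    point by at most \<open>r\<close>, hence keeps \<open>cball z r\<close> inside
    \<open>cball z (2 * r)\<close>. The summand 1 covers \<open>v\<close> = 0.\<close>
  define \<rho> where "\<rho> = r / (norm v + 1)"
  have \<rho>: "0 < \<rho>" using r by (simp add: \<rho>_def add_nonneg_pos)
  define s where "s n = complex_of_real (\<rho> / 2 * inverse (real (Suc n)))" for n
  have s0: "s n \<noteq> 0" for n using \<rho> by (simp add: s_def del: of_nat_Suc)
  have s_le: "cmod (s n) \<le> \<rho> / 2" for n
    unfolding s_def norm_of_real using \<rho> by (simp add: field_simps)
  have near: "w + c *s v \<in> cball z (2 * r)" if "w \<in> cball z r" "cmod c \<le> \<rho>" for w c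
  proof -
    have "norm (c *s v) \<le> \<rho> * norm v" using that by (simp add: norm_vector_smult mult_right_mono)
    also have "\<dots> \<le> \<rho> * (norm v + 1)" using \<rho> by simp
    also have "\<dots> = r" by (simp add: \<rho>_def add_nonneg_eq_0_iff)
    finally have "norm (w + c *s v - z) \<le> 2 * r"
      using that norm_triangle_ineq[of "w - z" "c *s v"]
      by (simp add: dist_norm norm_minus_commute algebra_simps)
    then show ?thesis by (simp add: dist_norm norm_minus_commute)
  qed
  have bound: "cmod ((g (w + s n *s v) - g w) / s n - directional_derivative g v w)
      \<le> 2 * M / (\<rho> / 4)\<^sup>2 * cmod (s n)" if "w \<in> cball z r" for w n
  proof -
    have "(\<lambda>c. g (w + c *s v)) holomorphic_on ball 0 \<rho>"
      by (rule holomorphic_on_subset[OF holo_fun_holomorphic_on_line[OF assms(2)]])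
        (use near[OF that] r in force)
    from holomorphic_difference_quotient_bound[OF this \<rho> _ s_le s0, of M n]
    show ?thesis using near[OF that] M by (simp add: directional_derivative_def)
  qed
  have "s \<longlonglongrightarrow> complex_of_real (\<rho> / 2 * 0)"
    unfolding s_def by (intro tendsto_of_real tendsto_mult_left LIMSEQ_inverse_real_of_nat)
  then have "s \<longlonglongrightarrow> 0" by simp
  then have small: "(\<lambda>n. 2 * M / (\<rho> / 4)\<^sup>2 * cmod (s n)) \<longlonglongrightarrow> 0"
    by (intro tendsto_mult_right_zero tendsto_norm_zero)
  have "uniform_limit (cball z r) (\<lambda>n w. (g (w + s n *s v) - g w) / s n) (directional_derivative g v) sequentially"
  proof (rule uniform_limitI)
    fix e :: real assume "0 < e"
    then have "\<forall>\<^sub>F n in sequentially. 2 * M / (\<rho> / 4)\<^sup>2 * cmod (s n) < e"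
      by (rule order_tendstoD(2)[OF small])
    then show "\<forall>\<^sub>F n in sequentially. \<forall>w\<in>cball z r.
        dist ((g (w + s n *s v) - g w) / s n) (directional_derivative g v w) < e"
      unfolding dist_norm by eventually_elim (blast intro: le_less_trans bound)
  qed
  show ?thesis
  proof (rule that)
    show "0 < r" by fact
    show "cball z r \<subseteq> U" using r by (auto simp: subset_iff)
    show "w + s n *s v \<in> U" if "w \<in> cball z r" for n w
      using near[OF that, of "s n"] s_le[of n] \<rho> r by auto
    show "s n \<noteq> 0" for n by (rule s0)
  qed fact
qed

lemma continuous_on_directional_derivative:
  assumes "open U" "holo_fun U g"
  shows "continuous_on U (directional_derivative g v)"
proof (rule continuous_at_imp_continuous_on, rule ballI)
  fix z assume "z \<in> U"
  obtain r s where r: "0 < r" "cball z r \<subseteq> U"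
    and s: "\<And>n w. w \<in> cball z r \<Longrightarrow> w + s n *s v \<in> U" "\<And>n. s n \<noteq> (0::complex)"
    and ul: "uniform_limit (cball z r) (\<lambda>n w. (g (w + s n *s v) - g w) / s n) (directional_derivative g v) sequentially"
    by (rule uniform_limit_difference_quotients[OF assms \<open>z \<in> U\<close>, of v]) (rule that)
  have "continuous_on (cball z r) (\<lambda>w. (g (w + s n *s v) - g w) / s n)" for n
  proof -
    have "continuous_on (cball z r) (\<lambda>w. g (w + s n *s v))"
    proof (rule continuous_on_compose2[OF holo_fun_continuous_on[OF assms(2)]])
      show "continuous_on (cball z r) (\<lambda>w. w + s n *s v)"
        by (rule continuous_on_add[OF continuous_on_id continuous_on_const])
      show "(\<lambda>w. w + s n *s v) ` cball z r \<subseteq> U"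
        by (rule image_subsetI) (rule s(1))
    qed
    moreover have "continuous_on (cball z r) g"
      using holo_fun_continuous_on[OF assms(2)] r(2) by (rule continuous_on_subset)
    ultimately show ?thesis
      using s(2) by (intro continuous_on_divide continuous_on_diff continuous_on_const) auto
  qed
  then have "continuous_on (cball z r) (directional_derivative g v)"
    by (intro uniform_limit_theorem[OF _ ul] always_eventually allI trivial_limit_sequentially)
  moreover have "z \<in> interior (cball z r)" using r(1) by simp
  ultimately show "isCont (directional_derivative g v) z"
    by (rule continuous_on_interior)
qed

text \<open>The base point runs along the line while the direction \<open>v\<close> is fixed; each
  quotient is then a one-variable holomorphic function, and so is their uniform limit.\<close>

lemma holomorphic_on_line_directional_derivative:
  assumes "open U" "holo_fun U g"
  shows "(\<lambda>t. directional_derivative g v (a + t *s b)) holomorphic_on {t. a + t *s b \<in> U}"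
  unfolding holomorphic_on_def
proof
  fix t0 assume "t0 \<in> {t. a + t *s b \<in> U}"
  define z where "z = a + t0 *s b"
  then have "z \<in> U" using \<open>t0 \<in> _\<close> by simp
  obtain r s where r: "0 < r" "cball z r \<subseteq> U"
    and s: "\<And>n w. w \<in> cball z r \<Longrightarrow> w + s n *s v \<in> U" "\<And>n. s n \<noteq> (0::complex)"
    and ul: "uniform_limit (cball z r) (\<lambda>n w. (g (w + s n *s v) - g w) / s n) (directional_derivative g v) sequentially"
    by (rule uniform_limit_difference_quotients[OF assms \<open>z \<in> U\<close>, of v]) (rule that)
  define d where "d = r / (norm b + 1)"
  have d: "0 < d" using r by (simp add: d_def add_nonneg_pos)
  have near: "a + t *s b \<in> cball z r" if "t \<in> cball t0 d" for t
  proof -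
    have "norm ((t - t0) *s b) \<le> d * norm b"
      using that unfolding norm_vector_smult by (simp add: mult_right_mono dist_norm norm_minus_commute)
    also have "\<dots> \<le> d * (norm b + 1)" using d by simp
    also have "\<dots> = r" by (simp add: d_def add_nonneg_eq_0_iff)
    finally have "norm ((t - t0) *s b) \<le> r" .
    moreover have "a + t *s b - z = (t - t0) *s b"
      by (simp add: z_def vec_eq_iff algebra_simps)
    ultimately show ?thesis by (metis dist_norm dist_commute mem_cball)
  qed
  let ?q = "\<lambda>n t. (g (a + t *s b + s n *s v) - g (a + t *s b)) / s n"
  have q: "?q n holomorphic_on cball t0 d" for n
  proof -
    have "(\<lambda>t. g ((a + s n *s v) + t *s b)) holomorphic_on cball t0 d"
      by (rule holomorphic_on_subset[OF holo_fun_holomorphic_on_line[OF assms(2)]])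
        (use s near in \<open>force simp: add_ac\<close>)
    moreover have "(\<lambda>t. g (a + t *s b)) holomorphic_on cball t0 d"
      by (rule holomorphic_on_subset[OF holo_fun_holomorphic_on_line[OF assms(2)]])
        (use r near in force)
    ultimately show ?thesis using s by (auto intro!: holomorphic_intros simp: add_ac)
  qed
  have ul': "uniform_limit (cball t0 d) ?q (\<lambda>t. directional_derivative g v (a + t *s b)) sequentially"
    using uniform_limit_compose'[OF ul, of "\<lambda>t. a + t *s b" "cball t0 d"] near by auto
  have ev: "\<forall>\<^sub>F n in sequentially. continuous_on (cball t0 d) (?q n) \<and> ?q n holomorphic_on ball t0 d"
    using q by (intro always_eventually allI conjI)
      (auto intro: holomorphic_on_imp_continuous_on holomorphic_on_subset[OF _ ball_subset_cball])
  have "(\<lambda>t. directional_derivative g v (a + t *s b)) holomorphic_on ball t0 d"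
    by (rule holomorphic_uniform_limit[OF ev ul' trivial_limit_sequentially])
  then show "(\<lambda>t. directional_derivative g v (a + t *s b)) field_differentiable at t0 within {t. a + t *s b \<in> U}"
    using d by (meson centre_in_ball field_differentiable_at_within holomorphic_on_imp_differentiable_at open_ball)
qed

lemma det_diagonal_const: "det (\<chi> i j. if i = j then c else 0 :: 'a::comm_ring_1^'n^'n) = c ^ CARD('n)"
  by (subst det_diagonal) auto

text \<open>The rotations by unit scalars preserve the ball and Lebesgue measure, so the integral may be
  averaged over them and the mean value inequality on the unit circle applies along complex lines.\<close>
lemma mean_value_inequality_ball:
  fixes u :: "complex^'n \<Rightarrow> complex"
  assumes cont: "continuous_on (ball 0 1) u"
    and hol: "\<And>\<zeta>. (\<lambda>t. u (t *s \<zeta>)) holomorphic_on {t. t *s \<zeta> \<in> ball 0 1}"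
    and int: "set_integrable lebesgue (ball 0 1) (\<lambda>\<zeta>. (cmod (u \<zeta>))\<^sup>2)"
  shows "(cmod (u 0))\<^sup>2 * measure lebesgue (ball (0 :: complex^'n) 1)
    \<le> (LINT \<zeta>:ball 0 1|lebesgue. (cmod (u \<zeta>))\<^sup>2)"
proof -
  let ?B = "ball (0 :: complex^'n) 1"
  let ?M = "LINT \<zeta>:?B|lebesgue. (cmod (u \<zeta>))\<^sup>2"
  define \<phi> where "\<phi> t \<zeta> = indicator ?B \<zeta> * ennreal ((cmod (u (cis t *s \<zeta>)))\<^sup>2)" for t \<zeta>
  have M0: "0 \<le> ?M"
    unfolding set_lebesgue_integral_def by (rule integral_nonneg_AE) simp
  have rot: "(\<integral>\<^sup>+\<zeta>. \<phi> t \<zeta> \<partial>lborel) = ennreal ?M" for t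
  proof -
    let ?H = "\<lambda>\<zeta> :: complex^'n. cis t *s \<zeta>"
    \<comment> \<open>The determinant of \<open>?J\<close> is a power of \<open>cis t\<close>, hence
      of modulus 1, and the Jacobian weight disappears.\<close>
    let ?J = "(\<chi> i j. if i = j then cis t else 0) :: complex^'n^'n"
    have J: "(*v) ?J = ?H"
      by (simp add: fun_eq_iff vec_eq_iff matrix_vector_mult_def if_distrib if_distribR cong: if_cong)
    have "bounded_linear ?H"
      by (simp add: linear_conv_bounded_linear[symmetric] linear_iff vec_eq_iff algebra_simps)
    then have der: "(?H has_derivative (*v) ?J) (at x within ?B)" for x
      unfolding J by (rule bounded_linear_imp_has_derivative)
    have inv: "?H (cis (- t) *s x) = x" for x by (simp add: vector_smult_assoc cis_mult)
    have inv': "cis (- t) *s ?H x = x" for x by (simp add: vector_smult_assoc cis_mult)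
    have inj: "inj_on ?H ?B" by (metis inj_onI inv')
    have img: "?H ` ?B = ?B"
    proof
      show "?B \<subseteq> ?H ` ?B"
      proof
        fix x :: "complex^'n" assume "x \<in> ?B"
        then have "cis (- t) *s x \<in> ?B" by (simp add: norm_vector_smult)
        then show "x \<in> ?H ` ?B" by (metis inv imageI)
      qed
    qed (auto simp: norm_vector_smult)
    have int': "set_integrable lebesgue (?H ` ?B) (\<lambda>\<zeta>. (cmod (u \<zeta>))\<^sup>2)" using int img by simp
    note cv = set_integral_holomorphic_change_of_variables[OF _ der inj int', unfolded det_diagonal_const img]
    have cv1: "set_integrable lebesgue ?B (\<lambda>\<zeta>. (cmod (u (?H \<zeta>)))\<^sup>2)"
      and cv2: "(LINT \<zeta>:?B|lebesgue. (cmod (u (?H \<zeta>)))\<^sup>2) = ?M"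
      using cv by (simp_all add: norm_power)
    have "(\<integral>\<^sup>+\<zeta>. \<phi> t \<zeta> \<partial>lborel) = (\<integral>\<^sup>+\<zeta>. ennreal (indicat_real ?B \<zeta> *\<^sub>R (cmod (u (?H \<zeta>)))\<^sup>2) \<partial>lebesgue)"
      by (simp add: \<phi>_def nn_integral_completion ennreal_mult' ennreal_indicator)
    also have "\<dots> = ennreal ?M"
      using nn_integral_eq_integral[OF cv1[unfolded set_integrable_def]] cv2
      by (simp add: set_lebesgue_integral_def)
    finally show ?thesis .
  qed
  let ?I = "{0..2 * pi}"
  \<comment> \<open>Regularity of \<open>u\<close> is known only on the open ball, so joint
    measurability is drawn from continuity on the product set, cut off by its indicator.\<close>
  have meas: "(\<lambda>(t, \<zeta>). indicator ?I t * \<phi> t \<zeta>) \<in> borel_measurable (lborel \<Otimes>\<^sub>M lborel)"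
  proof -
    let ?F = "\<lambda>p :: real \<times> (complex^'n). (cmod (u (cis (fst p) *s snd p)))\<^sup>2"
    have smult: "continuous_on S (\<lambda>p :: real \<times> (complex^'n). cis (fst p) *s snd p)" for S
      by (intro continuous_on_vector_smult continuous_intros)
    have "continuous_on (?I \<times> ?B) ?F"
      by (intro continuous_intros continuous_on_compose2[OF cont smult]) (auto simp: norm_vector_smult)
    then have "(\<lambda>p. indicat_real (?I \<times> ?B) p *\<^sub>R ?F p) \<in> borel_measurable borel"
      by (intro borel_measurable_continuous_on_indicator borel_Times) auto
    then have "(\<lambda>p. ennreal (indicat_real (?I \<times> ?B) p *\<^sub>R ?F p)) \<in> borel_measurable borel"
      by measurable
    moreover have "(\<lambda>(t, \<zeta>). indicator ?I t * \<phi> t \<zeta>) = (\<lambda>p. ennreal (indicat_real (?I \<times> ?B) p *\<^sub>R ?F p))"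
      by (auto simp: fun_eq_iff \<phi>_def indicator_def)
    ultimately show ?thesis by (simp add: lborel_prod)
  qed
  have vol: "emeasure lborel ?B = ennreal (measure lebesgue ?B)"
    using emeasure_lborel_ball_finite[of "0 :: complex^'n" 1]
    by (simp add: emeasure_eq_ennreal_measure less_top[symmetric] measure_completion)
  have "ennreal (2 * pi * (cmod (u 0))\<^sup>2 * measure lebesgue ?B)
      = (\<integral>\<^sup>+\<zeta>. ennreal (2 * pi * (cmod (u 0))\<^sup>2) * indicator ?B \<zeta> \<partial>lborel)"
    using vol by (simp add: nn_integral_cmult_indicator ennreal_mult')
  also have "\<dots> \<le> (\<integral>\<^sup>+\<zeta>. (\<integral>\<^sup>+t. indicator ?I t * \<phi> t \<zeta> \<partial>lborel) \<partial>lborel)"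
  proof (rule nn_integral_mono)
    fix \<zeta> :: "complex^'n"
    show "ennreal (2 * pi * (cmod (u 0))\<^sup>2) * indicator ?B \<zeta> \<le> (\<integral>\<^sup>+t. indicator ?I t * \<phi> t \<zeta> \<partial>lborel)"
    proof (cases "\<zeta> \<in> ?B")
      case True
      let ?h = "\<lambda>t. u (t *s \<zeta>)"
      have "cball 0 1 \<subseteq> {t. t *s \<zeta> \<in> ?B}"
      proof (clarify, unfold mem_ball_0 norm_vector_smult)
        fix t :: complex assume "t \<in> cball 0 1"
        then have "cmod t * norm \<zeta> \<le> norm \<zeta>" by (simp add: mult_left_le_one_le)
        with True show "cmod t * norm \<zeta> < 1" by simp
      qed
      then have "?h holomorphic_on cball 0 1" using hol holomorphic_on_subset by blast
      then have "ennreal (2 * pi * (cmod (?h 0))\<^sup>2)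
          \<le> (\<integral>\<^sup>+t. indicator ?I t * ennreal ((cmod (?h (cis t)))\<^sup>2) \<partial>lborel)"
        by (intro holomorphic_square_circle_mean holomorphic_on_imp_continuous_on)
          (auto elim: holomorphic_on_subset)
      then show ?thesis using True by (simp add: \<phi>_def)
    qed simp
  qed
  also have "\<dots> = (\<integral>\<^sup>+t. (\<integral>\<^sup>+\<zeta>. indicator ?I t * \<phi> t \<zeta> \<partial>lborel) \<partial>lborel)"
    using lborel_pair.Fubini'[OF meas] .
  also have "\<dots> = (\<integral>\<^sup>+t. ennreal ?M * indicator ?I t \<partial>lborel)"
  proof (rule nn_integral_cong)
    fix t :: real
    show "(\<integral>\<^sup>+\<zeta>. indicator ?I t * \<phi> t \<zeta> \<partial>lborel) = ennreal ?M * indicator ?I t"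
      using rot[of t] by (auto simp: indicator_def)
  qed
  also have "\<dots> = ennreal (2 * pi * ?M)"
    using M0 by (subst nn_integral_cmult_indicator) (simp_all add: ennreal_mult' mult.commute)
  finally have "2 * pi * (cmod (u 0))\<^sup>2 * measure lebesgue ?B \<le> 2 * pi * ?M"
    using M0 by (simp add: ennreal_le_iff)
  then show ?thesis by simp
qed

section \<open>Discs in the ball and the Bergman estimate\<close>

text \<open>Schwarz's lemma for the Cayley transform of 1 - \<phi>.\<close>
lemma borel_caratheodory_derivative:
  assumes hol: "\<phi> holomorphic_on ball 0 1" and re: "\<And>\<zeta>. \<zeta> \<in> ball 0 1 \<Longrightarrow> Re (\<phi> \<zeta>) < 1"
  shows "Re (\<phi> 0) + cmod (deriv \<phi> 0) / 2 \<le> 1"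
proof -
  define p where "p \<zeta> = 1 - \<phi> \<zeta>" for \<zeta>
  define q where "q \<zeta> = (p \<zeta> - p 0) / (p \<zeta> + cnj (p 0))" for \<zeta>
  have p: "0 < Re (p \<zeta>)" if "cmod \<zeta> < 1" for \<zeta> using re[of \<zeta>] that by (simp add: p_def)
  have p0: "0 < Re (p 0)" by (rule p) simp
  have nz: "p \<zeta> + cnj (p 0) \<noteq> 0" if "cmod \<zeta> < 1" for \<zeta>
    using p[OF that] p0 by (auto simp: complex_eq_iff)
  have holp: "p holomorphic_on ball 0 1"
    unfolding p_def[abs_def] by (intro holomorphic_intros hol)
  have holq: "q holomorphic_on ball 0 1"
    unfolding q_def[abs_def] using nz by (intro holomorphic_intros holp) auto
  have "cmod (q \<zeta>) < 1" if "cmod \<zeta> < 1" for \<zeta>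
  proof -
    \<comment> \<open>Positivity of this difference of squares is the reason why the transform sends
      the right half-plane into the unit disc.\<close>
    have "0 < 4 * Re (p \<zeta>) * Re (p 0)" using p[OF that] p0 by simp
    also have "\<dots> = (cmod (p \<zeta> + cnj (p 0)))\<^sup>2 - (cmod (p \<zeta> - p 0))\<^sup>2"
      unfolding cmod_power2 by (simp add: power2_eq_square algebra_simps)
    finally have "cmod (p \<zeta> - p 0) < cmod (p \<zeta> + cnj (p 0))"
      by (simp add: power2_less_imp_less)
    then show ?thesis using nz[OF that] by (simp add: q_def norm_divide)
  qed
  then have "cmod (deriv q 0) \<le> 1"
    using Schwarz_Lemma(2)[OF holq, of 0] by (simp add: q_def)
  moreover have "deriv q 0 = - deriv \<phi> 0 / (2 * Re (p 0))"
  proof (rule DERIV_imp_deriv)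
    have "(\<phi> has_field_derivative deriv \<phi> 0) (at 0)"
      using hol by (simp add: holomorphic_derivI)
    then have dp: "(p has_field_derivative - deriv \<phi> 0) (at 0)"
      unfolding p_def[abs_def] by (auto intro!: derivative_eq_intros)
    have "((\<lambda>\<zeta>. (p \<zeta> - p 0) / (p \<zeta> + cnj (p 0))) has_field_derivative
        ((- deriv \<phi> 0 - 0) * (p 0 + cnj (p 0)) - (p 0 - p 0) * (- deriv \<phi> 0 + 0)) /
        ((p 0 + cnj (p 0)) * (p 0 + cnj (p 0)))) (at 0)"
      using nz[of 0] by (intro DERIV_divide DERIV_diff DERIV_add dp DERIV_const) simp_all
    then show "(q has_field_derivative - deriv \<phi> 0 / (2 * Re (p 0))) (at 0)"
      unfolding q_def[abs_def] using nz[of 0] by (simp add: complex_add_cnj)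
  qed
  ultimately have "cmod (deriv \<phi> 0) / (2 * Re (p 0)) \<le> 1"
    using p0 by (simp add: norm_divide norm_mult)
  then have "cmod (deriv \<phi> 0) \<le> 2 * Re (p 0)" using p0 by (simp add: divide_le_eq)
  then show ?thesis by (simp add: p_def)
qed

text \<open>Convexity of the ball reduces this to real parts of linear functionals.\<close>
lemma tangent_disc_in_cball:
  fixes g :: "complex \<Rightarrow> complex^'n"
  assumes g: "holo_curve (ball 0 1) g" and sub: "g ` ball 0 1 \<subseteq> ball 0 1"
    and der: "(g has_derivative (\<lambda>h. h *s w)) (at 0)" and \<zeta>: "cmod \<zeta> \<le> 1"
  shows "g 0 + (\<zeta> / 2) *s w \<in> cball 0 1"
proof (cases "g 0 + (\<zeta> / 2) *s w = 0")
  case False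
  define y where "y = g 0 + (\<zeta> / 2) *s w"
  define u where "u = y /\<^sub>R norm y"
  have y: "norm y > 0" using False by (simp add: y_def)
  then have u: "norm u = 1" by (simp add: u_def)
  \<comment> \<open>A complex-linear functional whose real part is the real inner product with
    \<open>u\<close>. It norms \<open>y\<close>, so a bound on its real part at \<open>y\<close>
    bounds \<open>norm y\<close>.\<close>
  define \<Phi> where "\<Phi> x = (\<Sum>i\<in>UNIV. cnj (u $ i) * x $ i)" for x
  have \<Phi>_inner: "Re (\<Phi> x) = u \<bullet> x" for x
    by (simp add: \<Phi>_def inner_vec_def inner_complex_def)
  have \<Phi>_smult: "\<Phi> (c *s x) = c * \<Phi> x" for c x
    by (simp add: \<Phi>_def sum_distrib_left mult.left_commute)
  have \<Phi>_add: "\<Phi> (x + x') = \<Phi> x + \<Phi> x'" for x x'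
    by (simp add: \<Phi>_def sum.distrib algebra_simps)
  have "bounded_linear \<Phi>"
    using \<Phi>_add \<Phi>_smult[of "of_real _"]
    by (auto simp: linear_conv_bounded_linear[symmetric] linear_iff \<Phi>_def scaleR_conv_of_real[where 'a=complex]
        sum_distrib_left mult.left_commute)
  then have \<Phi>_der: "((\<lambda>t. \<Phi> (g t)) has_field_derivative \<Phi> v) (at t)"
    if "(g has_derivative (\<lambda>h. h *s v)) (at t)" for t v
    using bounded_linear.has_derivative[of \<Phi> g "\<lambda>h. h *s v"] that
    by (simp add: has_field_derivative_def \<Phi>_smult mult.commute[of _ "\<Phi> v"])
  have "(\<lambda>t. \<Phi> (g t)) holomorphic_on ball 0 1"
    unfolding holomorphic_on_def
    using g \<Phi>_der unfolding holo_curve_def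
    by (meson field_differentiable_at_within field_differentiable_def)
  moreover have "Re (\<Phi> (g t)) < 1" if "t \<in> ball 0 1" for t
  proof -
    have "norm (g t) < 1" using that sub by (auto simp: image_subset_iff)
    then show ?thesis using norm_cauchy_schwarz[of u "g t"] u by (simp add: \<Phi>_inner)
  qed
  ultimately have "Re (\<Phi> (g 0)) + cmod (\<Phi> w) / 2 \<le> 1"
    using borel_caratheodory_derivative[of "\<lambda>t. \<Phi> (g t)"] DERIV_imp_deriv[OF \<Phi>_der[OF der]] by simp
  moreover have "Re (\<zeta> / 2 * \<Phi> w) \<le> cmod (\<Phi> w) / 2"
  proof -
    have "Re (\<zeta> / 2 * \<Phi> w) \<le> cmod (\<zeta> / 2 * \<Phi> w)" by (rule complex_Re_le_cmod)
    also have "\<dots> \<le> cmod (\<Phi> w) / 2" using \<zeta> by (simp add: norm_mult norm_divide mult_left_le_one_le)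
    finally show ?thesis .
  qed
  moreover have "norm y = Re (\<Phi> y)"
    using y by (simp add: \<Phi>_inner u_def power2_norm_eq_inner[symmetric] power2_eq_square)
  moreover have "Re (\<Phi> y) = Re (\<Phi> (g 0)) + Re (\<zeta> / 2 * \<Phi> w)"
    by (simp only: y_def \<Phi>_add \<Phi>_smult plus_complex.sel)
  ultimately have "norm y \<le> 1" by linarith
  then show ?thesis by (simp add: y_def)
qed simp

section \<open>Affine images of the ball from discs in coordinate directions\<close>

lemma complex_linear_expand:
  fixes L :: "complex^'n \<Rightarrow> complex^'m"
  assumes "linear L" "\<And>c v. L (c *s v) = c *s L v"
  shows "L x = (\<Sum>j\<in>UNIV. x $ j *s L (axis j 1))"
proof -
  have "L x = L (\<Sum>j\<in>UNIV. x $ j *s axis j 1)" by (simp add: basis_expansion)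
  then show ?thesis using assms by (simp add: linear_sum)
qed

text \<open>Average over the coordinate directions the affine discs tangent to the curves F o f j; the final
  midpoint with F z moves from the closed to the open ball.\<close>
lemma ball_affine_subset:
  fixes L :: "complex^'n \<Rightarrow> complex^'n"
  assumes F: "holo_map U F" "F ` U \<subseteq> ball 0 1" "z \<in> U"
    and L: "(F has_derivative L) (at z)" "\<And>c v. L (c *s v) = c *s L v"
    and disc: "\<And>j. holo_curve (ball 0 1) (f j)" "\<And>j. f j ` cball 0 (1/2) \<subseteq> U" "\<And>j. f j 0 = z"
      "\<And>j. (f j has_derivative (\<lambda>h. h *s (complex_of_real (r j) *s axis j 1))) (at 0)"
    and R: "0 < R" "\<And>j. R \<le> r j" and \<zeta>: "\<zeta> \<in> ball 0 1"
  shows "F z + complex_of_real (R / (8 * real CARD('n))) *s L \<zeta> \<in> ball 0 1"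
proof -
  have linL: "linear L" using L(1) has_derivative_linear by blast
  have p: "F z + (\<zeta> $ j * (R / 4)) *s L (axis j 1) \<in> cball 0 1" for j
  proof -
    \<comment> \<open>The disc is known to lie in \<open>U\<close> only for parameters in
      \<open>cball 0 (1/2)\<close>; halving the parameter restores the unit disc and halves the
      derivative.\<close>
    let ?g = "\<lambda>t. F (f j (t / 2))"
    have half: "((\<lambda>t::complex. t / 2) has_derivative (\<lambda>h. h / 2)) (at t)" for t
      by (auto intro!: derivative_eq_intros)
    have chain: "(?g has_derivative (\<lambda>h. h *s ((1/2) *s K w))) (at t)"
      if "(f j has_derivative (\<lambda>h. h *s w)) (at (t / 2))" "(F has_derivative K) (at (f j (t / 2)))"
        "\<And>c v. K (c *s v) = c *s K v" for t w K
    proof -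
      have "(F \<circ> (f j \<circ> (\<lambda>t. t / 2)) has_derivative K \<circ> ((\<lambda>h. h *s w) \<circ> (\<lambda>h. h / 2))) (at t)"
        using that by (intro diff_chain_at half) simp_all
      moreover have "K \<circ> ((\<lambda>h. h *s w) \<circ> (\<lambda>h. h / 2)) = (\<lambda>h. h *s ((1/2) *s K w))"
        by (simp add: fun_eq_iff that(3))
      ultimately show ?thesis by (simp add: o_def)
    qed
    have in_U: "f j (t / 2) \<in> U" if "t \<in> ball 0 1" for t
      using disc(2)[of j] that by (force simp: norm_divide)
    have "holo_curve (ball 0 1) ?g"
      unfolding holo_curve_def
    proof
      fix t :: complex assume t: "t \<in> ball 0 1"
      then have "t / 2 \<in> ball 0 1" by (simp add: norm_divide)
      then obtain w where "(f j has_derivative (\<lambda>h. h *s w)) (at (t / 2))"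
        using disc(1)[of j] unfolding holo_curve_def by blast
      moreover obtain K where "(F has_derivative K) (at (f j (t / 2)))" "\<And>c v. K (c *s v) = c *s K v"
        using F(1) in_U[OF t] unfolding holo_map_def by blast
      ultimately show "\<exists>w. (?g has_derivative (\<lambda>h. h *s w)) (at t)" using chain by blast
    qed
    moreover have "?g ` ball 0 1 \<subseteq> ball 0 1" using in_U F(2) by blast
    moreover have "(?g has_derivative (\<lambda>h. h *s ((1/2) *s L (complex_of_real (r j) *s axis j 1)))) (at 0)"
      by (rule chain) (use disc L in simp_all)
    \<comment> \<open>The discs have different speeds \<open>r j\<close>. Using
      \<open>\<zeta> $ j * (R / r j)\<close> as the parameter equalises them: every direction is
      displaced by \<open>R / 4\<close> times \<open>\<zeta> $ j\<close>.\<close>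
    moreover have "cmod (\<zeta> $ j * (R / r j)) \<le> 1"
    proof -
      have "cmod (\<zeta> $ j) \<le> 1" using Finite_Cartesian_Product.norm_nth_le[of \<zeta> j] \<zeta> by simp
      moreover have "R / r j \<le> 1" "0 \<le> R / r j" using R(1) R(2)[of j] by (simp_all add: divide_le_eq_1)
      ultimately have "cmod (\<zeta> $ j) * (R / r j) \<le> 1 * 1" by (intro mult_mono) auto
      then show ?thesis using R(1) R(2)[of j] by (simp add: norm_mult norm_divide)
    qed
    ultimately have "?g 0 + ((\<zeta> $ j * (R / r j)) / 2) *s ((1/2) *s L (complex_of_real (r j) *s axis j 1)) \<in> cball 0 1"
      by (rule tangent_disc_in_cball)
    moreover have "r j \<noteq> 0" using R(1) R(2)[of j] by simp
    ultimately show ?thesis by (simp add: disc(3) L(2) field_simps)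
  qed
  let ?k = "real CARD('n)"
  have k: "?k > 0" by simp
  define P where "P = (\<Sum>j\<in>UNIV. F z + (\<zeta> $ j * (R / 4)) *s L (axis j 1))"
  have "P = of_nat CARD('n) *s F z + complex_of_real (R / 4) *s L \<zeta>"
    unfolding complex_linear_expand[OF linL L(2), of \<zeta>] P_def
    by (simp only: vec_eq_iff sum_component vector_add_component vector_smult_component sum.distrib)
      (simp add: sum_distrib_left mult_ac)
  then have P_nth: "P $ i = of_nat CARD('n) * F z $ i + complex_of_real (R / 4) * L \<zeta> $ i" for i
    by simp
  have "F z + complex_of_real (R / (8 * ?k)) *s L \<zeta> = (1/2) *\<^sub>R F z + (1 / (2 * ?k)) *\<^sub>R P"
    by (simp add: vec_eq_iff scaleR_conv_of_real[where 'a=complex] P_nth) (simp add: field_simps)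
  also have "norm \<dots> \<le> (1/2) * norm (F z) + (1 / (2 * ?k)) * norm P"
    using norm_triangle_ineq[of "(1/2) *\<^sub>R F z" "(1 / (2 * ?k)) *\<^sub>R P"] by simp
  also have "\<dots> < 1"
  proof -
    have "norm (F z) < 1" using F by auto
    have "norm P \<le> ?k" unfolding P_def using p by (intro norm_sum[THEN order_trans] sum_bounded_above[THEN order_trans]) auto
    then have "(1 / (2 * ?k)) * norm P \<le> 1/2" using k by (simp add: field_simps)
    with \<open>norm (F z) < 1\<close> show ?thesis by linarith
  qed
  finally show ?thesis by simp
qed

text \<open>The real \<open>Inf\<close> is unspecified on the empty set, so the value 0 is
  informative only once a competing disc is exhibited; a small affine disc in direction
  \<open>v\<close> serves. Some 1 / \<open>r\<close> then lies below 1 / \<open>R\<close>.\<close>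

lemma kobayashi_royden_zero_disc:
  fixes z v :: "complex^'n"
  assumes "open \<Omega>" "z \<in> \<Omega>" "kobayashi_royden \<Omega> z v = 0" "0 < R"
  obtains r f where "R < r" "holo_curve (ball 0 1) f" "f ` ball 0 1 \<subseteq> \<Omega>" "f 0 = z"
    "(f has_derivative (\<lambda>h. h *s (complex_of_real r *s v))) (at 0)"
proof -
  let ?D = "\<lambda>r f. holo_curve (ball 0 1) f \<and> f ` ball 0 1 \<subseteq> \<Omega> \<and> f 0 = z \<and>
           (f has_derivative (\<lambda>h. h *s (complex_of_real r *s v))) (at 0)"
  let ?S = "{1 / r | r. r > 0 \<and> (\<exists>f. ?D r f)}"
  obtain e where e: "0 < e" "ball z e \<subseteq> \<Omega>" using assms openE by blast
  define d where "d = e / (norm v + 1)"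
  have d: "0 < d" using e by (simp add: d_def add_nonneg_pos)
  have "d * norm v \<le> d * (norm v + 1)" using d by simp
  also have "\<dots> = e" by (simp add: d_def add_nonneg_eq_0_iff)
  finally have "d * norm v \<le> e" .
  define f where "f t = z + t *s (complex_of_real d *s v)" for t
  have der: "(f has_derivative (\<lambda>h. h *s (complex_of_real d *s v))) (at t)" for t
    unfolding f_def[abs_def] by (rule has_derivative_complex_line)
  have "f t \<in> ball z e" if "t \<in> ball 0 1" for t
  proof (cases "v = 0")
    case False
    have "cmod t * (d * norm v) < 1 * (d * norm v)"
      using that d False by (intro mult_strict_right_mono) auto
    then have "cmod t * (d * norm v) < e" using \<open>d * norm v \<le> e\<close> by linarith
    then have "norm (t *s (complex_of_real d *s v)) < e"
      using d by (simp only: norm_vector_smult) simp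
    then show ?thesis by (simp add: f_def dist_norm)
  qed (use e in \<open>simp add: f_def\<close>)
  then have "f ` ball 0 1 \<subseteq> \<Omega>" using e by blast
  moreover have "holo_curve (ball 0 1) f" unfolding holo_curve_def using der by blast
  moreover have "f 0 = z" by (simp add: f_def)
  ultimately have "?D d f" using der by blast
  then have "1 / d \<in> ?S" using d by (intro CollectI exI[of _ d] conjI exI[of _ f]) auto
  then have ne: "?S \<noteq> {}" by (intro notI) (simp only: empty_iff)
  have less: "Inf ?S < 1 / R" using assms by (simp add: kobayashi_royden_def)
  obtain x where "x \<in> ?S" "x < 1 / R" using cInf_lessD[OF ne less] by (elim bexE) (rule that)
  then obtain r f where r: "0 < r" "1 / r < 1 / R" and f: "?D r f" by (elim CollectE exE conjE) simp
  have "R < r" using r \<open>0 < R\<close> by (simp add: field_simps)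
  with f show ?thesis by (intro that[of r f]) simp_all
qed

section \<open>Exhaustion and the Bergman estimate at a point\<close>

lemma compact_subset_increasing_union:
  fixes \<Omega>s :: "nat \<Rightarrow> 'a::topological_space set"
  assumes "compact K" "K \<subseteq> (\<Union>i\<in>{1..}. \<Omega>s i)" "\<And>i. i \<ge> 1 \<Longrightarrow> open (\<Omega>s i)"
    and mono: "\<And>i j. 1 \<le> i \<Longrightarrow> i \<le> j \<Longrightarrow> \<Omega>s i \<subseteq> \<Omega>s j"
  obtains N where "1 \<le> N" "\<And>i. N \<le> i \<Longrightarrow> K \<subseteq> \<Omega>s i"
proof -
  obtain C where C: "C \<subseteq> {1..}" "finite C" "K \<subseteq> (\<Union>i\<in>C. \<Omega>s i)"
    using compactE_image[OF assms(1), of "{1..}" \<Omega>s] assms(2,3) by auto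
  define N where "N = Max (insert 1 C)"
  have N: "j \<le> N" if "j \<in> C" for j using C that by (simp add: N_def)
  show ?thesis
  proof (rule that)
    show "1 \<le> N" using C by (simp add: N_def)
    fix i assume "N \<le> i"
    show "K \<subseteq> \<Omega>s i"
    proof
      fix x assume "x \<in> K"
      then obtain j where "j \<in> C" "x \<in> \<Omega>s j" using C by blast
      moreover have "1 \<le> j" "j \<le> i" using C N[OF \<open>j \<in> C\<close>] \<open>j \<in> C\<close> \<open>N \<le> i\<close> by auto
      ultimately show "x \<in> \<Omega>s i" using mono by blast
    qed
  qed
qed

text \<open>Here \<open>L\<close> is inverted by the derivative \<open>M\<close> of \<open>G\<close>
  at \<open>a\<close>. The composite \<open>H\<close> therefore has derivative \<open>\<mu>\<close>
  times the identity at 0, with determinant \<open>\<mu> ^ CARD('n)\<close>, however strongly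
  \<open>G\<close> distorts.\<close>

lemma weighted_jacobian_estimate:
  fixes G :: "complex^'n \<Rightarrow> complex^'n" and f :: "complex^'n \<Rightarrow> complex"
  assumes f: "holo_fun \<Omega> f" "set_integrable lebesgue \<Omega> (\<lambda>z. (cmod (f z))\<^sup>2)"
    and G: "holo_map (ball 0 1) G" "inj_on G (ball 0 1)" "G ` ball 0 1 \<subseteq> \<Omega>"
    and A: "\<And>\<zeta>. \<zeta> \<in> ball 0 1 \<Longrightarrow> a + complex_of_real \<mu> *s L \<zeta> \<in> ball 0 1" "0 < \<mu>"
    and L: "bounded_linear L" "\<And>c v. L (c *s v) = c *s L v" "inj L"
    and M: "(G has_derivative M) (at a)" "\<And>v. M (L v) = v" "\<And>c v. M (c *s v) = c *s M v"
  shows "(cmod (f (G a)))\<^sup>2 * \<mu> ^ (2 * CARD('n)) * measure lebesgue (ball (0::complex^'n) 1)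
    \<le> (LINT z:\<Omega>|lebesgue. (cmod (f z))\<^sup>2)"
proof -
  let ?B = "ball (0::complex^'n) 1"
  define A where "A \<zeta> = a + complex_of_real \<mu> *s L \<zeta>" for \<zeta>
  define H where "H = G \<circ> A"
  have L0: "L 0 = 0" using L(1) by (simp add: bounded_linear.linear linear_0)
  have A0: "A 0 = a" by (simp add: A_def L0)
  have AB: "A \<zeta> \<in> ?B" if "\<zeta> \<in> ?B" for \<zeta> using A(1)[OF that] by (simp add: A_def)
  have bl: "bounded_linear (\<lambda>x :: complex^'n. c *s x)" for c
    by (simp add: linear_conv_bounded_linear[symmetric] linear_iff vec_eq_iff algebra_simps)
  have derA: "(A has_derivative (\<lambda>v. complex_of_real \<mu> *s L v)) (at \<zeta>)" for \<zeta>
    unfolding A_def[abs_def]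
    by (auto intro!: derivative_eq_intros bounded_linear_imp_has_derivative bounded_linear_compose[OF bl L(1)])
  have injH: "inj_on H ?B"
  proof (rule inj_onI)
    fix x y assume xy: "x \<in> ?B" "y \<in> ?B" "H x = H y"
    then have "A x = A y" using G(2) AB by (auto simp: H_def inj_on_def)
    then have "L x = L y" using A(2) by (simp add: A_def vec_eq_iff)
    then show "x = y" using L(3) by (simp add: injD)
  qed
  have HB: "H \<zeta> \<in> \<Omega>" if "\<zeta> \<in> ?B" for \<zeta> using AB[OF that] G(3) by (auto simp: H_def)
  have derH_ex: "\<exists>K. (H has_derivative K) (at \<zeta>) \<and> (\<forall>c v. K (c *s v) = c *s K v)" if \<zeta>: "\<zeta> \<in> ?B" for \<zeta>
  proof -
    obtain K where K: "(G has_derivative K) (at (A \<zeta>))" "\<And>c v. K (c *s v) = c *s K v"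
      using G(1) AB[OF \<zeta>] unfolding holo_map_def by blast
    have "(H has_derivative K \<circ> (\<lambda>v. complex_of_real \<mu> *s L v)) (at \<zeta>)"
      unfolding H_def by (rule diff_chain_at[OF derA K(1)])
    then show ?thesis using K(2) L(2)
      by (intro exI[of _ "K \<circ> (\<lambda>v. complex_of_real \<mu> *s L v)"]) (simp add: vector_smult_assoc mult.commute)
  qed
  \<comment> \<open>Directional derivatives as entries make the regularity lemmas above available
    for \<open>det (J \<zeta>)\<close>; \<open>J_eq\<close> identifies \<open>J\<close> with any
    complex-linear derivative of \<open>H\<close>.\<close>
  define J :: "complex^'n \<Rightarrow> complex^'n^'n" where
    "J \<zeta> = (\<chi> i j. directional_derivative (\<lambda>w. H w $ i) (axis j 1) \<zeta>)" for \<zeta>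
  have comp: "((\<lambda>w. H w $ i) has_derivative (\<lambda>v. K v $ i)) (at \<zeta>)"
    if "(H has_derivative K) (at \<zeta>)" for \<zeta> K i
    using bounded_linear.has_derivative[OF bounded_linear_vec_nth that] .
  have J_eq: "K = (*v) (J \<zeta>)"
    if K: "(H has_derivative K) (at \<zeta>)" "\<And>c v. K (c *s v) = c *s K v" for \<zeta> K
  proof
    fix v
    have "J \<zeta> $ i $ j = K (axis j 1) $ i" for i j
      unfolding J_def using directional_derivative_eq[OF comp[OF K(1)]] K(2) by simp
    then show "K v = J \<zeta> *v v"
      using complex_linear_expand[OF has_derivative_linear[OF K(1)] K(2), of v]
      by (simp add: vec_eq_iff matrix_vector_mult_def mult.commute)
  qed
  have derH: "(H has_derivative (*v) (J \<zeta>)) (at \<zeta>)" if "\<zeta> \<in> ?B" for \<zeta>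
    using derH_ex[OF that] J_eq by blast
  have holoH: "holo_fun ?B (\<lambda>w. H w $ i)" for i
    unfolding holo_fun_def
  proof
    fix \<zeta> assume "\<zeta> \<in> ?B"
    then obtain K where "(H has_derivative K) (at \<zeta>)" "\<And>c v. K (c *s v) = c *s K v"
      using derH_ex by blast
    then show "\<exists>L. ((\<lambda>w. H w $ i) has_derivative L) (at \<zeta>) \<and> (\<forall>c v. L (c *s v) = c * L v)"
      using comp by (intro exI[of _ "\<lambda>v. K v $ i"]) simp
  qed
  have holofH: "holo_fun ?B (\<lambda>w. f (H w))"
    unfolding holo_fun_def
  proof
    fix \<zeta> assume \<zeta>: "\<zeta> \<in> ?B"
    obtain K where K: "(H has_derivative K) (at \<zeta>)" "\<And>c v. K (c *s v) = c *s K v"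
      using derH_ex[OF \<zeta>] by blast
    obtain Q where Q: "(f has_derivative Q) (at (H \<zeta>))" "\<And>c v. Q (c *s v) = c * Q v"
      using f(1) HB[OF \<zeta>] unfolding holo_fun_def by blast
    show "\<exists>L. ((\<lambda>w. f (H w)) has_derivative L) (at \<zeta>) \<and> (\<forall>c v. L (c *s v) = c * L v)"
      using diff_chain_at[OF K(1) Q(1)] K(2) Q(2)
      by (intro exI[of _ "Q \<circ> K"]) (simp add: o_def)
  qed
  define u where "u \<zeta> = det (J \<zeta>) * f (H \<zeta>)" for \<zeta>
  have J_cont: "continuous_on ?B (\<lambda>\<zeta>. J \<zeta> $ i $ j)" for i j
    unfolding J_def by (simp add: continuous_on_directional_derivative holoH)
  have J_hol: "(\<lambda>t. J (t *s \<zeta>) $ i $ j) holomorphic_on {t. t *s \<zeta> \<in> ?B}" for i j \<zeta>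
    using holomorphic_on_line_directional_derivative
        [where v = "axis j 1" and a = 0 and b = \<zeta>, OF open_ball holoH]
    by (simp add: J_def)
  have cont: "continuous_on ?B u"
    unfolding u_def[abs_def] det_def
    by (intro continuous_on_mult continuous_on_sum continuous_on_prod continuous_on_const J_cont
        holo_fun_continuous_on holofH)
  have hol: "(\<lambda>t. u (t *s \<zeta>)) holomorphic_on {t. t *s \<zeta> \<in> ?B}" for \<zeta>
    unfolding u_def[abs_def] det_def
    using holo_fun_holomorphic_on_line[OF holofH, of 0 \<zeta>]
    by (intro holomorphic_on_mult holomorphic_on_sum holomorphic_on_prod holomorphic_on_const J_hol) simp
  have "continuous_on ?B H"
    using derH by (meson continuous_at_imp_continuous_on has_derivative_continuous)
  \<comment> \<open>Invariance of domain is used here to obtain measurability of the image.\<close>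
  then have "open (H ` ?B)" using injH by (intro invariance_of_domain) auto
  then have HBm: "H ` ?B \<in> sets lebesgue" by (simp add: borel_open)
  have HBsub: "H ` ?B \<subseteq> \<Omega>" using HB by blast
  have intH: "set_integrable lebesgue (H ` ?B) (\<lambda>z. (cmod (f z))\<^sup>2)"
    using f(2) HBm HBsub by (rule set_integrable_subset)
  have u2: "(cmod (u \<zeta>))\<^sup>2 = (cmod (det (J \<zeta>)))\<^sup>2 * (cmod (f (H \<zeta>)))\<^sup>2" for \<zeta>
    by (simp add: u_def norm_mult power_mult_distrib)
  note cv = set_integral_holomorphic_change_of_variables
    [OF _ has_derivative_at_withinI[OF derH] injH intH, folded u2]
  have "(cmod (u 0))\<^sup>2 * measure lebesgue ?B \<le> (LINT \<zeta>:?B|lebesgue. (cmod (u \<zeta>))\<^sup>2)"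
    by (rule mean_value_inequality_ball[OF cont hol cv(1)]) simp_all
  also have "\<dots> = (LINT z:H ` ?B|lebesgue. (cmod (f z))\<^sup>2)"
    by (rule cv(2)) simp_all
  also have "\<dots> \<le> (LINT z:\<Omega>|lebesgue. (cmod (f z))\<^sup>2)"
    unfolding set_lebesgue_integral_def
    using f(2) intH HBsub unfolding set_integrable_def
    by (intro integral_mono) (auto simp: indicator_def)
  finally have le: "(cmod (u 0))\<^sup>2 * measure lebesgue ?B \<le> (LINT z:\<Omega>|lebesgue. (cmod (f z))\<^sup>2)" .
  have "(H has_derivative M \<circ> (\<lambda>v. complex_of_real \<mu> *s L v)) (at 0)"
    unfolding H_def by (rule diff_chain_at[OF derA]) (simp add: A0 M(1))
  moreover have "M \<circ> (\<lambda>v. complex_of_real \<mu> *s L v) = (\<lambda>v. complex_of_real \<mu> *s v)"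
    by (simp add: fun_eq_iff M)
  ultimately have "(H has_derivative (\<lambda>v. complex_of_real \<mu> *s v)) (at 0)" by simp
  then have J0: "(\<lambda>v. complex_of_real \<mu> *s v) = (*v) (J 0)"
    by (rule J_eq) (simp add: vector_smult_assoc mult.commute)
  have "J 0 = (\<chi> i j. if i = j then complex_of_real \<mu> else 0)"
    unfolding matrix_eq
    using fun_cong[OF J0]
    by (simp add: vec_eq_iff matrix_vector_mult_def if_distrib if_distribR cong: if_cong)
  then have "det (J 0) = complex_of_real \<mu> ^ CARD('n)" by (simp add: det_diagonal_const)
  then have "(cmod (u 0))\<^sup>2 = (cmod (f (G a)))\<^sup>2 * \<mu> ^ (2 * CARD('n))"
    using A(2) by (simp add: u2 H_def A0 norm_power power_mult[symmetric] mult.commute)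
  with le show ?thesis by simp
qed

lemma bergman_estimate_at_kobayashi_zero:
  fixes \<Omega>s :: "nat \<Rightarrow> (complex^'n) set"
  defines "\<Omega> \<equiv> \<Union>i\<in>{1..}. \<Omega>s i"
  assumes dom: "\<And>i. i \<ge> 1 \<Longrightarrow> open (\<Omega>s i) \<and> biholomorphic (\<Omega>s i) (ball 0 1)"
    and mono: "\<And>i j. 1 \<le> i \<Longrightarrow> i \<le> j \<Longrightarrow> \<Omega>s i \<subseteq> \<Omega>s j"
    and z: "z \<in> \<Omega>" and kob: "\<And>v. kobayashi_royden \<Omega> z v = 0"
    and f: "f \<in> bergman_space \<Omega>" and R: "0 < R"
  shows "(cmod (f z))\<^sup>2 * (R / (8 * real CARD('n))) ^ (2 * CARD('n)) * measure lebesgue (ball (0::complex^'n) 1)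
    \<le> (LINT z:\<Omega>|lebesgue. (cmod (f z))\<^sup>2)"
proof -
  have "open \<Omega>" unfolding \<Omega>_def using dom by blast
  define D where "D j r g \<longleftrightarrow> R < r \<and> holo_curve (ball 0 1) g \<and> g ` ball 0 1 \<subseteq> \<Omega> \<and> g 0 = z \<and>
      (g has_derivative (\<lambda>h. h *s (complex_of_real r *s axis j 1))) (at 0)"
    for j :: 'n and r g
  have "\<exists>r g. D j r g" for j
    by (rule kobayashi_royden_zero_disc[OF \<open>open \<Omega>\<close> z kob R, of "axis j 1"])
      (unfold D_def, blast)
  then obtain r g where D: "\<And>j. D j (r j) (g j)" by metis
  \<comment> \<open>A full open disc need not lie in one member of the exhaustion, but the compact
    image of the closed half disc does.\<close>
  have "\<exists>N\<ge>1. \<forall>i\<ge>N. g j ` cball 0 (1/2) \<subseteq> \<Omega>s i" for j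
  proof -
    have sub: "cball 0 (1/2) \<subseteq> ball (0::complex) 1" by auto
    have "continuous_on (ball 0 1) (g j)"
      using D[of j] unfolding D_def holo_curve_def
      by (meson continuous_at_imp_continuous_on has_derivative_continuous)
    then have "compact (g j ` cball 0 (1/2))"
      using sub by (intro compact_continuous_image compact_cball) (rule continuous_on_subset)
    moreover have "g j ` cball 0 (1/2) \<subseteq> (\<Union>i\<in>{1..}. \<Omega>s i)"
      using D[of j] sub unfolding D_def \<Omega>_def by blast
    ultimately show ?thesis
      by (rule compact_subset_increasing_union) (use dom mono in blast)+
  qed
  then obtain N where N: "\<And>j. 1 \<le> N j" "\<And>j i. N j \<le> i \<Longrightarrow> g j ` cball 0 (1/2) \<subseteq> \<Omega>s i" by metis
  obtain m where m: "1 \<le> m" "z \<in> \<Omega>s m" using z unfolding \<Omega>_def by auto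
  \<comment> \<open>One index beyond all those required by the finitely many discs and by
    \<open>z\<close>, so that a single biholomorphic map serves every direction.\<close>
  define p where "p = Max (insert m (range N))"
  have p: "m \<le> p" "N j \<le> p" for j unfolding p_def by (rule Max_ge; simp)+
  have "1 \<le> p" using m(1) p(1) by simp
  define U where "U = \<Omega>s p"
  have U: "open U" "z \<in> U" "U \<subseteq> \<Omega>" "\<And>j. g j ` cball 0 (1/2) \<subseteq> U"
    using dom[OF \<open>1 \<le> p\<close>] m mono[OF m(1) p(1)] p(2) \<open>1 \<le> p\<close> N(2) by (auto simp: U_def \<Omega>_def)
  have "biholomorphic U (ball 0 1)" using dom[OF \<open>1 \<le> p\<close>] by (simp add: U_def)
  then obtain F G :: "complex^'n \<Rightarrow> complex^'n" where FG: "holo_map U F \<and> holo_map (ball 0 1) G \<and> F ` U = ball 0 1 \<and> G ` ball 0 1 = U \<and>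
      (\<forall>z\<in>U. G (F z) = z) \<and> (\<forall>w\<in>ball 0 1. F (G w) = w)"
    unfolding biholomorphic_def by (elim exE) (rule that)
  then have F: "holo_map U F" "F ` U = ball 0 1" and G: "holo_map (ball 0 1) G" "G ` ball 0 1 = U"
    by simp_all
  have GF: "G (F z) = z" if "z \<in> U" for z using FG that by blast
  have Fz: "F z \<in> ball 0 1" using F(2) U(2) by blast
  obtain L where L: "(F has_derivative L) (at z)" "\<And>c v. L (c *s v) = c *s L v"
    using F(1) U(2) unfolding holo_map_def by blast
  obtain M where M: "(G has_derivative M) (at (F z))" "\<And>c v. M (c *s v) = c *s M v"
    using G(1) Fz unfolding holo_map_def by blast
  \<comment> \<open>\<open>G\<close> inverts \<open>F\<close> only on \<open>U\<close>, which is an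
    open neighbourhood of \<open>z\<close>; uniqueness of derivatives then makes \<open>M\<close> a
    left inverse of \<open>L\<close>.\<close>
  have "((\<lambda>x. x) has_derivative M \<circ> L) (at z)"
    by (rule has_derivative_transform_within_open[OF diff_chain_at[OF L(1) M(1)] U(1,2)]) (simp add: GF)
  then have "M \<circ> L = (\<lambda>x. x)" using has_derivative_ident by (rule has_derivative_unique)
  then have left_inv: "M (L v) = v" for v by (simp add: fun_eq_iff)
  have "(cmod (f (G (F z))))\<^sup>2 * (R / (8 * real CARD('n))) ^ (2 * CARD('n)) * measure lebesgue (ball (0::complex^'n) 1)
    \<le> (LINT z:\<Omega>|lebesgue. (cmod (f z))\<^sup>2)"
  proof (rule weighted_jacobian_estimate[where f = f and G = G and a = "F z" and L = L and M = M])
    show "holo_fun \<Omega> f" "set_integrable lebesgue \<Omega> (\<lambda>z. (cmod (f z))\<^sup>2)"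
      using f by (auto simp: bergman_space_def)
    show "inj_on G (ball 0 1)" using FG by (metis inj_onI)
    show "G ` ball 0 1 \<subseteq> \<Omega>" using G(2) U(3) by simp
    show "bounded_linear L" using L(1) by (rule has_derivative_bounded_linear)
    show "inj L" by (metis left_inv injI)
    show "0 < R / (8 * real CARD('n))" using R by simp
    show "F z + complex_of_real (R / (8 * real CARD('n))) *s L \<zeta> \<in> ball 0 1" if "\<zeta> \<in> ball 0 1" for \<zeta>
      by (rule ball_affine_subset[OF F(1) _ U(2) L _ U(4) _ _ R _ that, where r = r])
        (use D F(2) in \<open>auto simp: D_def intro: less_imp_le\<close>)
  qed (use G(1) L(2) M left_inv in auto)
  then show ?thesis by (simp add: GF U(2))
qed

theorem theorem1p1:
  fixes \<Omega>s :: "nat \<Rightarrow> (complex^'n) set"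
  assumes "CARD('n) \<ge> 2"
    and "\<And>i. i \<ge> 1 \<Longrightarrow> domain (\<Omega>s i) \<and> biholomorphic (\<Omega>s i) (ball 0 1)"
    and "\<And>i. i \<ge> 1 \<Longrightarrow> \<Omega>s i \<subseteq> \<Omega>s (Suc i)"
    and "\<forall>z\<in>(\<Union>i\<in>{1..}. \<Omega>s i). \<forall>v. kobayashi_royden (\<Union>i\<in>{1..}. \<Omega>s i) z v = 0"
  shows "emeasure lebesgue (\<Union>i\<in>{1..}. \<Omega>s i) = \<infinity> \<and>
         (\<forall>f\<in>bergman_space (\<Union>i\<in>{1..}. \<Omega>s i). \<forall>z\<in>(\<Union>i\<in>{1..}. \<Omega>s i). f z = 0)"
proof -
  define \<Omega> where "\<Omega> = (\<Union>i\<in>{1..}. \<Omega>s i)"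
  have dom: "open (\<Omega>s i) \<and> biholomorphic (\<Omega>s i) (ball 0 1)" if "i \<ge> 1" for i
    using assms(2)[OF that] by (simp add: domain_def)
  have mono: "\<Omega>s i \<subseteq> \<Omega>s j" if "1 \<le> i" "i \<le> j" for i j
    using that(2) by (induction j rule: dec_induct) (use assms(3) that(1) in \<open>auto simp: subset_iff\<close>)
  have zero: "f z = 0" if f: "f \<in> bergman_space \<Omega>" and z: "z \<in> \<Omega>" for f z
  proof (rule ccontr)
    assume "f z \<noteq> 0"
    let ?n = "2 * CARD('n)" and ?I = "LINT z:\<Omega>|lebesgue. (cmod (f z))\<^sup>2"
    define q where "q = (cmod (f z))\<^sup>2 * measure lebesgue (ball (0::complex^'n) 1)"
    have q: "0 < q" using \<open>f z \<noteq> 0\<close> content_ball_pos[of 1 "0::complex^'n"]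
      by (simp add: q_def measure_completion)
    have kob: "kobayashi_royden (\<Union>i\<in>{1..}. \<Omega>s i) z v = 0" for v
      using assms(4) z unfolding \<Omega>_def by blast
    \<comment> \<open>The choice R = 8 n t absorbs the constant, so \<open>t\<close> plays the role
      of \<open>\<mu>\<close>.\<close>
    have bound: "q * t ^ ?n \<le> ?I" if "0 < t" for t
      using bergman_estimate_at_kobayashi_zero[OF dom mono z[unfolded \<Omega>_def] kob f[unfolded \<Omega>_def],
          of "8 * real CARD('n) * t", folded \<Omega>_def] that
      by (simp add: q_def mult_ac)
    \<comment> \<open>With \<open>t\<close> at least 1 its power is at least \<open>t\<close>, and
      \<open>q * t\<close> is at least \<open>?I + q\<close>, which exceeds
      \<open>?I\<close>.\<close>
    define t where "t = max 1 (?I / q + 1)"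
    have "t \<le> t ^ ?n" by (rule self_le_power) (simp_all add: t_def)
    moreover have "?I < q * t" using q by (simp add: t_def max_def field_simps)
    ultimately have "?I < q * t ^ ?n" using q by (smt (verit) mult_left_mono)
    moreover have "0 < t" by (simp add: t_def)
    ultimately show False using bound by fastforce
  qed
  have "emeasure lebesgue \<Omega> = \<infinity>"
  proof (rule ccontr)
    assume fin: "emeasure lebesgue \<Omega> \<noteq> \<infinity>"
    have "open \<Omega>" unfolding \<Omega>_def using dom by blast
    then have "(\<lambda>z. 1) \<in> bergman_space \<Omega>"
      using fin
      by (auto simp: bergman_space_def holo_fun_def set_integrable_def top.not_eq_extremum borel_open
          intro!: exI[of _ "\<lambda>_. 0"])
    moreover obtain z where "z \<in> \<Omega>" using assms(2)[of 1] unfolding \<Omega>_def domain_def by force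
    ultimately show False using zero by fastforce
  qed
  with zero show ?thesis unfolding \<Omega>_def by blast
qed

end
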